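(* Let $p>1$, $Q\ge 2$ and $\delta>1$, let $\varepsilon=\varepsilon(p,\delta,Q)$, and let $s^-=s^-(\varepsilon)$. If $q\in\left(\frac{1}{s^-},0\right)$, then for every $(x,y)\in\Omega_\delta$, with $r^-=u_p^-\!\left(\frac{y^{1/p}}{\varepsilon x}\right)$, $$ \mathcal{B}(x,y;p,q,\delta,Q)\;\le\; x^{q}\,\frac{1-qr^-}{1-qs^-}\left(\frac{1-s^-}{1-r^-}\right)^{q} = y^{\frac{q}{p}}\,\frac{1-qr^-}{1-qs^-}\left(\frac{1-ps^-}{1-pr^-}\right)^{\frac{q}{p}} . $$
   Context: Dyadic intervals: $D=\{[n2^{-k},(n+1)2^{-k}]: n,k\in\mathbb{Z}\}$. For an interval $J\in D$, $D(J)=\{I\in D: I\subset J\}$. For $I\in D$, $I^*$ denotes its dyadic parent, i.e. the smallest dyadic interval strictly containing $I$. $\langle f\rangle_I=\frac1{|I|}\int_I f(x)\,dx$. A weight is a locally integrable, almost everywhere positive function $w$ on $\mathbb{R}$. The dyadic doubling constant of $w$ is $Db^d(w)=\sup_{I\in D}\frac{\langle w\rangle_{I^*}}{\langle w\rangle_I}$. For $p>1$, $w\in RH_p^{\delta,d}(J)$ means $\sup_{I\in D(J)}\frac{\langle w^p\rangle_I^{1/p}}{\langle w\rangle_I}\le\delta$. Fix a dyadic interval $J$ (the quantities below do not depend on the choice of $J$). Domain: $$\Omega_\delta=\{(x_1,x_2): \exists\, w\in RH_p^{\delta,d}(J) \text{ with } Db^d(w)\le Q,\ x_1=\langle w\rangle_J,\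 x_2=\langle w^p\rangle_J\}.$$ Bellman function: for $q<0$ and $(x_1,x_2)\in\Omega_\delta$, $$\mathcal{B}(x_1,x_2;p,q,\delta,Q)=\sup\{\langle w^q\rangle_J: w\in RH_p^{\delta,d}(J),\ Db^d(w)\le Q,\ \langle w\rangle_J=x_1,\ \langle w^p\rangle_J=x_2\}.$$ For $0< t\le 1$, $u_p^-(t)$ denotes the non-positive solution $u$ of $(1-pu)^{1/p}(1-u)^{-1}=t$ (it is negative for $t<1$ and $u_p^-(1)=0$). Put $H=\frac{Q^p-1}{Q-1}$, $\varepsilon(p,\delta,Q)=\frac{H}{p}\left(\frac{p-1}{H-1}\right)^{\frac{p-1}{p}}\delta$, and $s^-(\varepsilon)=u_p^-\!\left(\frac1\varepsilon\right)$. *)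

theory Defs
  imports "HOL-Analysis.Analysis"
begin

definition dyadic_intervals :: "real set set" where
  "dyadic_intervals =
     {{of_int n * 2 powi (- k) .. (of_int n + 1) * 2 powi (- k)} | n k :: int. True}"

definition dyadic_subintervals :: "real set \<Rightarrow> real set set" where
  "dyadic_subintervals J = {I \<in> dyadic_intervals. I \<subseteq> J}"

(* The order on sets is inclusion, so LEAST picks the smallest dyadic interval
   strictly containing I. *)
definition dyadic_parent :: "real set \<Rightarrow> real set" where
  "dyadic_parent I = (LEAST K. K \<in> dyadic_intervals \<and> I \<subset> K)"

definition weight :: "(real \<Rightarrow> real) \<Rightarrow> bool" where
  "weight w \<longleftrightarrow>
     (\<forall>K. compact K \<longrightarrow> set_integrable lebesgue K w) \<and> (AE x in lebesgue. w x > 0)"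

(* The mean of f over I with values in [0, \<infinity>]. It is only applied to measurable f that are
   nonnegative almost everywhere; if f is not integrable over I the mean is \<infinity>
   (and not 0, as it would be with the Bochner integral). *)
definition mean :: "(real \<Rightarrow> real) \<Rightarrow> real set \<Rightarrow> ereal" where
  "mean f I =
     enn2ereal (set_nn_integral lebesgue I (\<lambda>x. ennreal (f x))) / ereal (measure lebesgue I)"

(* Powers of extended nonnegative numbers with a positive exponent. *)
definition epowr :: "ereal \<Rightarrow> real \<Rightarrow> ereal" where
  "epowr a r = (if a = \<infinity> then \<infinity> else ereal (real_of_ereal a powr r))"

definition dyadic_doubling_const :: "(real \<Rightarrow> real) \<Rightarrow> ereal" where
  "dyadic_doubling_const w = (SUP I\<in>dyadic_intervals. mean w (dyadic_parent I) / mean w I)"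

definition RH_dyadic :: "real \<Rightarrow> real \<Rightarrow> real set \<Rightarrow> (real \<Rightarrow> real) set" where
  "RH_dyadic p \<delta> J =
     {w. weight w \<and>
         (SUP I\<in>dyadic_subintervals J. epowr (mean (\<lambda>x. w x powr p) I) (1 / p) / mean w I)
           \<le> ereal \<delta>}"

definition bellman_domain :: "real \<Rightarrow> real \<Rightarrow> real \<Rightarrow> real set \<Rightarrow> (real \<times> real) set" where
  "bellman_domain p \<delta> Q J =
     {(x1, x2). \<exists>w \<in> RH_dyadic p \<delta> J. dyadic_doubling_const w \<le> ereal Q \<and>
         ereal x1 = mean w J \<and> ereal x2 = mean (\<lambda>x. w x powr p) J}"

definition bellman ::
    "real \<Rightarrow> real \<Rightarrow> real \<Rightarrow> real \<Rightarrow> real \<Rightarrow> real \<Rightarrow> real set \<Rightarrow> ereal" where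
  "bellman x1 x2 p q \<delta> Q J =
     Sup {mean (\<lambda>x. w x powr q) J | w.
            w \<in> RH_dyadic p \<delta> J \<and> dyadic_doubling_const w \<le> ereal Q \<and>
            mean w J = ereal x1 \<and> mean (\<lambda>x. w x powr p) J = ereal x2}"

(* The solution is unique for p > 1 and 0 < t \<le> 1: on u \<le> 0 the left-hand side increases
   strictly and continuously from the limit 0 at -\<infinity> to the value 1 at u = 0. *)
definition u_minus :: "real \<Rightarrow> real \<Rightarrow> real" where
  "u_minus p t = (THE u. u \<le> 0 \<and> (1 - p * u) powr (1 / p) * inverse (1 - u) = t)"

definition H_const :: "real \<Rightarrow> real \<Rightarrow> real" where
  "H_const p Q = (Q powr p - 1) / (Q - 1)"

definition eps_const :: "real \<Rightarrow> real \<Rightarrow> real \<Rightarrow> real" where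
  "eps_const p \<delta> Q =
     H_const p Q / p * ((p - 1) / (H_const p Q - 1)) powr ((p - 1) / p) * \<delta>"

definition s_minus :: "real \<Rightarrow> real \<Rightarrow> real" where
  "s_minus p \<epsilon> = u_minus p (1 / \<epsilon>)"

end

theory Submission
  imports Defs
begin

text \<open>
  Write \<open>z = y / \<epsilon>\<^sup>p\<close>. In these coordinates the right-hand side is a positive constant times a function
  \<open>E x z\<close> (\<open>envelope\<close> below) on the region \<open>0 < z \<le> x\<^sup>p\<close> under the power curve.
  Through every point of the region passes a unique tangent to the curve whose point of tangency \<open>a\<close>
  satisfies \<open>0 < a \<le> x\<close>, and to the right of \<open>a\<close> the function \<open>E\<close> is affine along that tangent. The parameter
  \<open>r\<close> of the statement encodes the tangent through \<open>(x, z)\<close>, because \<open>x = a (1 - r)\<close> and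
  \<open>z = a\<^sup>p (1 - p r)\<close>, and \<open>s\<close> is its value when \<open>y = x\<^sup>p\<close>.

  The proof has three ingredients.

  \<^item> \<open>E\<close> is concave along the dyadic splittings that can occur. The plane tangent to the graph of \<open>E\<close> at \<open>P\<close>
    (\<open>support_line\<close>) lies above \<open>E\<close> at every point joined to \<open>P\<close> by a segment under the curve. This
    is because moving \<open>a\<close> changes the height of the plane over \<open>(x, z)\<close> at a rate whose sign is that of the
    difference between the height of the tangent at \<open>a\<close> and \<open>z\<close>, so that \<open>E x z\<close> is the minimum of these
    heights over \<open>0 < a \<le> x\<close> (\<open>tangent_value_le_support_line\<close>, \<open>envelope_midpoint\<close>).

  \<^item> The segments stay under the curve. If a dyadic interval and its two halves have means \<open>x\<close>, \<open>x\<^sub>1\<close>,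
    \<open>x\<^sub>2\<close>, then doubling gives \<open>x \<le> Q x\<^sub>i\<close>, and all three points satisfy \<open>y \<le> \<delta>\<^sup>p x\<^sup>p\<close>. The constant
    \<open>\<epsilon>\<close> is the smallest one for which the chords of \<open>\<delta>\<^sup>p x\<^sup>p\<close> over intervals of endpoint ratio at most
    \<open>Q\<close> lie below \<open>\<epsilon>\<^sup>p x\<^sup>p\<close> (\<open>chord_le_chord_excess\<close>). Only the half of the segment to the left
    of the midpoint matters, so the ratio is \<open>x / x\<^sub>1\<close> and not \<open>x\<^sub>2 / x\<^sub>1\<close>.

  \<^item> Passing to the limit. On \<open>y \<ge> x\<^sup>p\<close> the right-hand side is at least \<open>x\<^sup>q\<close>. Splitting \<open>J\<close>
    repeatedly, midpoint concavity bounds the integral of \<open>w\<^sub>m\<^sup>q\<close>, with \<open>w\<^sub>m\<close> the dyadic averages of \<open>w\<close>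
    of generation \<open>m\<close>, by the value at \<open>J\<close> (\<open>nn_integral_dyadic_step_le\<close>). As \<open>w\<^sub>m\<close> tends to \<open>w\<close> almost
    everywhere by Lebesgue differentiation, Fatou's lemma finishes the proof.
\<close>

section \<open>Tangent lines of a power function\<close>

text \<open>
  The height at \<open>x\<close> of the tangent to \<open>t\<^sup>e\<close> at \<open>t = a\<close>. The exponent \<open>e = p\<close> describes the tangents
  that foliate the region, the exponent \<open>e = q\<close> the values of the envelope along them.
\<close>
definition tangent_line :: "real \<Rightarrow> real \<Rightarrow> real \<Rightarrow> real" where
  "tangent_line e a x = (1 - e) * a powr e + e * x * a powr (e - 1)"

lemma tangent_line_self: "a > 0 \<Longrightarrow> tangent_line e a a = a powr e"
  by (simp add: tangent_line_def powr_diff field_simps)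

lemma tangent_line_scale:
  assumes "0 < c" "0 < a"
  shows "tangent_line e (c * a) (c * x) = c powr e * tangent_line e a x"
  using assms by (simp add: tangent_line_def powr_mult powr_diff field_simps)

lemma tangent_line_convex_comb:
  "tangent_line e a ((1 - l) * x + l * x') = (1 - l) * tangent_line e a x + l * tangent_line e a x'"
  by (simp add: tangent_line_def algebra_simps)

text \<open>
  When the point of tangency moves, the height over a fixed \<open>x\<close> changes at a rate whose sign depends only on the
  side of \<open>x\<close> on which \<open>a\<close> lies. For \<open>e = p\<close> the height therefore increases up to \<open>a = x\<close> and
  decreases afterwards; this unimodality carries all of the geometry below.
\<close>
lemma DERIV_tangent_line_base:
  assumes "a > 0"
  shows "((\<lambda>a. tangent_line e a x) has_real_derivative e * (1 - e) * a powr (e - 2) * (a - x)) (at a)"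
proof -
  have "((\<lambda>a. tangent_line e a x) has_real_derivative
      (1 - e) * (e * a powr (e - 1)) + e * x * ((e - 1) * a powr (e - 1 - 1))) (at a)"
    unfolding tangent_line_def
    by (rule derivative_eq_intros refl | use assms in simp)+
  moreover have "a powr (e - 1) = a powr (e - 2) * a"
    using assms by (simp flip: powr_add add: powr_mult_base mult.commute)
  ultimately show ?thesis
    by (simp add: algebra_simps)
qed

lemma tangent_line_strict_mono:
  assumes "1 < p" "0 < a" "a < b" "b \<le> x"
  shows "tangent_line p a x < tangent_line p b x"
proof (rule DERIV_pos_imp_increasing_open[OF assms(3)])
  fix c assume c: "a < c" "c < b"
  have "p * (1 - p) * c powr (p - 2) * (c - x) > 0"
    using assms c by (intro mult_neg_neg mult_neg_pos mult_pos_neg) auto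
  then show "\<exists>y. ((\<lambda>a. tangent_line p a x) has_real_derivative y) (at c) \<and> 0 < y"
    using DERIV_tangent_line_base[of c p x] assms c by auto
next
  show "continuous_on {a..b} (\<lambda>a. tangent_line p a x)"
    unfolding tangent_line_def using assms by (intro continuous_intros) auto
qed

lemma tangent_line_strict_antimono:
  assumes "1 < p" "0 < x" "x \<le> a" "a < b"
  shows "tangent_line p b x < tangent_line p a x"
proof (rule DERIV_neg_imp_decreasing_open[OF assms(4)])
  fix c assume c: "a < c" "c < b"
  have "p * (1 - p) * c powr (p - 2) * (c - x) < 0"
    using assms c by (intro mult_neg_pos mult_pos_neg) auto
  then show "\<exists>y. ((\<lambda>a. tangent_line p a x) has_real_derivative y) (at c) \<and> y < 0"
    using DERIV_tangent_line_base[of c p x] assms c by auto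
next
  show "continuous_on {a..b} (\<lambda>a. tangent_line p a x)"
    unfolding tangent_line_def using assms by (intro continuous_intros) auto
qed

lemma tangent_line_mono_neg:
  assumes "q < 0" "0 < a" "a \<le> b" "b \<le> x"
  shows "tangent_line q a x \<le> tangent_line q b x"
proof (rule DERIV_nonneg_imp_nondecreasing[OF assms(3)])
  fix c assume c: "a \<le> c" "c \<le> b"
  have "q * (1 - q) * c powr (q - 2) * (c - x) \<ge> 0"
    using assms c by (intro mult_nonpos_nonpos mult_nonpos_nonneg) auto
  then show "\<exists>y. ((\<lambda>a. tangent_line q a x) has_real_derivative y) (at c) \<and> 0 \<le> y"
    using DERIV_tangent_line_base[of c q x] assms c by auto
qed

lemma tangent_line_less_powr:
  assumes "1 < p" "0 < a" "0 < x" "a \<noteq> x"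
  shows "tangent_line p a x < x powr p"
proof (cases "a < x")
  case True
  then show ?thesis
    using tangent_line_strict_mono[of p a x x] tangent_line_self[of x p] assms by simp
next
  case False
  then show ?thesis
    using tangent_line_strict_antimono[of p x x a] tangent_line_self[of x p] assms by simp
qed

lemma tangent_line_le_powr:
  assumes "1 < p" "0 < a" "0 < x"
  shows "tangent_line p a x \<le> x powr p"
  using tangent_line_less_powr[OF assms] tangent_line_self[of x p] assms by (cases "a = x") auto

text \<open>
  An affine function of \<open>(x, z)\<close>. For \<open>z = tangent_line p a x\<close> it equals \<open>tangent_line q a x\<close>, and the
  coefficient of \<open>z\<close> is \<open>\<partial>\<^sub>a tangent_line q a x / \<partial>\<^sub>a tangent_line p a x\<close>, in which \<open>x\<close> cancels. That is what
  makes it tangent to the graph of the envelope along the whole tangent line at \<open>a\<close>.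
\<close>
definition support_line :: "real \<Rightarrow> real \<Rightarrow> real \<Rightarrow> real \<Rightarrow> real \<Rightarrow> real" where
  "support_line p q a x z = tangent_line q a x
     + q * (1 - q) / (p * (1 - p)) * a powr (q - p) * (z - tangent_line p a x)"

lemma support_line_midpoint:
  "2 * support_line p q a ((x1 + x2) / 2) ((z1 + z2) / 2)
     = support_line p q a x1 z1 + support_line p q a x2 z2"
proof -
  define k where "k = q * (1 - q) / (p * (1 - p)) * a powr (q - p)"
  have "tangent_line e a ((x1 + x2) / 2) = (tangent_line e a x1 + tangent_line e a x2) / 2" for e
    by (simp add: tangent_line_def field_simps)
  then show ?thesis
    unfolding support_line_def k_def[symmetric] by (simp add: field_simps)
qed

text \<open>
  The derivatives of the two tangent heights cancel by the choice of the coefficient of \<open>z\<close>; only the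
  derivative of that coefficient survives.
\<close>
lemma DERIV_support_line_base:
  assumes "1 < p" "a > 0"
  shows "((\<lambda>a. support_line p q a x z) has_real_derivative
    q * (1 - q) / (p * (1 - p)) * (q - p) * a powr (q - p - 1) * (z - tangent_line p a x)) (at a)"
proof -
  define k where "k = q * (1 - q) / (p * (1 - p))"
  have k: "k * (p * (1 - p)) = q * (1 - q)"
    using assms by (simp add: k_def)
  have "((\<lambda>a. support_line p q a x z) has_real_derivative
      q * (1 - q) * a powr (q - 2) * (a - x) +
      (k * ((q - p) * a powr (q - p - 1)) * (z - tangent_line p a x)
       + - (p * (1 - p) * a powr (p - 2) * (a - x)) * (k * a powr (q - p)))) (at a)"
    unfolding support_line_def k_def[symmetric]
    by (rule derivative_eq_intros DERIV_tangent_line_base refl | use assms in simp)+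
  \<comment> \<open>The cancellation: the coefficient \<open>k a\<^sup>q\<^sup>-\<^sup>p\<close> is the quotient of the two derivatives.\<close>
  moreover have "q * (1 - q) * a powr (q - 2) * (a - x)
      = p * (1 - p) * a powr (p - 2) * (a - x) * (k * a powr (q - p))"
  proof -
    have "a powr (q - 2) = a powr (p - 2) * a powr (q - p)"
      by (simp flip: powr_add)
    then show ?thesis
      by (simp flip: k)
  qed
  ultimately show ?thesis
    by (simp add: k_def mult_ac)
qed

lemma support_line_slope_coeff:
  assumes "1 < p" "q < 0"
  shows "q * (1 - q) / (p * (1 - p)) * (q - p) < (0::real)"
  using assms by (intro mult_pos_neg divide_neg_neg mult_neg_pos mult_pos_neg) auto

lemma support_line_mono:
  assumes "1 < p" "q < 0" "0 < a" "a \<le> b" "\<And>c. a \<le> c \<Longrightarrow> c \<le> b \<Longrightarrow> z \<le> tangent_line p c x"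
  shows "support_line p q a x z \<le> support_line p q b x z"
proof (rule DERIV_nonneg_imp_nondecreasing[OF assms(4)])
  fix c assume c: "a \<le> c" "c \<le> b"
  have "q * (1 - q) / (p * (1 - p)) * (q - p) * c powr (q - p - 1) * (z - tangent_line p c x) \<ge> 0"
    using assms(5)[OF c]
    by (intro mult_nonpos_nonpos[OF mult_nonpos_nonneg[OF
          less_imp_le[OF support_line_slope_coeff[OF assms(1,2)]]]]) auto
  then show "\<exists>y. ((\<lambda>a. support_line p q a x z) has_real_derivative y) (at c) \<and> 0 \<le> y"
    using DERIV_support_line_base[of p c q x z] assms c by auto
qed

lemma support_line_antimono:
  assumes "1 < p" "q < 0" "0 < a" "a \<le> b" "\<And>c. a \<le> c \<Longrightarrow> c \<le> b \<Longrightarrow> tangent_line p c x \<le> z"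
  shows "support_line p q b x z \<le> support_line p q a x z"
proof (rule DERIV_nonpos_imp_nonincreasing[OF assms(4)])
  fix c assume c: "a \<le> c" "c \<le> b"
  have "q * (1 - q) / (p * (1 - p)) * (q - p) * c powr (q - p - 1) * (z - tangent_line p c x) \<le> 0"
    using assms(5)[OF c]
    by (intro mult_nonpos_nonneg[OF mult_nonpos_nonneg[OF
          less_imp_le[OF support_line_slope_coeff[OF assms(1,2)]]]]) auto
  then show "\<exists>y. ((\<lambda>a. support_line p q a x z) has_real_derivative y) (at c) \<and> y \<le> 0"
    using DERIV_support_line_base[of p c q x z] assms c by auto
qed

text \<open>
  As \<open>a\<close> varies, the support heights over \<open>(x, z)\<close> decrease while the tangent at \<open>a\<close> passes below the point and
  increase while it passes above it. They are thus smallest at the left tangency \<open>b\<close>. The second case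
  of the last hypothesis lets \<open>a\<close> pass \<open>x\<close>, as long as the point is still below the tangent at \<open>a\<close>:
  by unimodality it is then below all the tangents at points between \<open>b\<close> and \<open>a\<close>.
\<close>
lemma tangent_value_le_support_line:
  assumes "1 < p" "q < 0" "0 < b" "b \<le> x" "tangent_line p b x = z"
    and "0 < a" "a \<le> x \<or> z \<le> tangent_line p a x"
  shows "tangent_line q b x \<le> support_line p q a x z"
proof -
  have "tangent_line q b x = support_line p q b x z"
    using assms by (simp add: support_line_def)
  also have "\<dots> \<le> support_line p q a x z"
  proof (cases "a \<le> b")
    case True
    show ?thesis
    proof (rule support_line_antimono)
      fix c assume "a \<le> c" "c \<le> b"
      then show "tangent_line p c x \<le> z"
        using tangent_line_strict_mono[of p c b x] assms by (cases "c = b") auto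
    qed (use assms True in auto)
  next
    case False
    show ?thesis
    proof (rule support_line_mono)
      fix c assume c: "b \<le> c" "c \<le> a"
      show "z \<le> tangent_line p c x"
      proof (cases "c \<le> x")
        case True
        then show ?thesis
          using tangent_line_strict_mono[of p b c x] assms c by (cases "c = b") auto
      next
        case False
        then show ?thesis
          using tangent_line_strict_antimono[of p x c a] assms c by (cases "c = a") auto
      qed
    qed (use assms False in auto)
  qed
  finally show ?thesis .
qed

lemma tangent_line_unit:
  assumes "u \<le> 0"
  shows "tangent_line e (1 / (1 - u)) 1 = (1 - e * u) * (1 - u) powr (- e)"
proof -
  have "tangent_line e (1 / (1 - u)) 1 = (1 / (1 - u)) powr e * (1 - e + e * (1 - u))"
    using assms by (simp add: tangent_line_def powr_diff field_simps)
  also have "(1 / (1 - u)) powr e = (1 - u) powr (- e)"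
    using assms by (simp add: powr_divide powr_minus field_simps)
  finally show ?thesis
    by (simp add: algebra_simps)
qed

text \<open>
  By homogeneity the equation that defines \<open>u\<^sub>p\<^sup>-\<close> is the one for a tangent through a point with abscissa
  \<open>1\<close>, whose point of tangency is \<open>1 / (1 - u)\<close>.
\<close>
lemma u_minus_equation_iff:
  assumes "1 < p" "u \<le> 0" "0 < t"
  shows "(1 - p * u) powr (1 / p) * inverse (1 - u) = t
    \<longleftrightarrow> tangent_line p (1 / (1 - u)) 1 = t powr p"
proof -
  have "p * u \<le> 0"
    using assms by (simp add: mult_le_0_iff)
  then have pos: "0 < 1 - p * u" "0 < 1 - u"
    using assms by auto
  define l where "l = (1 - p * u) powr (1 / p) * inverse (1 - u)"
  have "l > 0" using pos by (simp add: l_def)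
  have "l powr p = tangent_line p (1 / (1 - u)) 1"
    unfolding tangent_line_unit[OF assms(2)] l_def using pos assms
    by (simp add: powr_mult powr_powr powr_minus inverse_powr)
  then have "tangent_line p (1 / (1 - u)) 1 = t powr p \<longleftrightarrow> l powr p = t powr p"
    by simp
  also have "\<dots> \<longleftrightarrow> l = t"
    using powr_less_mono2[of p l t] powr_less_mono2[of p t l] \<open>l > 0\<close> assms
    by (cases l t rule: linorder_cases) auto
  finally show ?thesis
    unfolding l_def by simp
qed

lemma u_minus_solves:
  assumes "1 < p" "0 < t" "t \<le> 1"
  shows "u_minus p t \<le> 0"
    and "tangent_line p (1 / (1 - u_minus p t)) 1 = t powr p"
proof -
  let ?P = "\<lambda>u. u \<le> 0 \<and> (1 - p * u) powr (1 / p) * inverse (1 - u) = t"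
  have "\<exists>a\<ge>0. a \<le> 1 \<and> tangent_line p a 1 = t powr p"
  proof (rule IVT')
    show "continuous_on {0..1} (\<lambda>a. tangent_line p a 1)"
      unfolding tangent_line_def using assms by (intro continuous_intros continuous_on_powr') auto
    show "tangent_line p 0 1 \<le> t powr p"
      by (simp add: tangent_line_def)
    show "t powr p \<le> tangent_line p 1 1"
      using assms by (simp add: tangent_line_self powr_le1)
  qed simp
  then obtain a where a: "0 \<le> a" "a \<le> 1" "tangent_line p a 1 = t powr p"
    by blast
  have "a \<noteq> 0"
    using a(3) assms by (auto simp: tangent_line_def)
  then have a0: "0 < a" using a by simp
  have ex: "?P (1 - 1 / a)"
    using a a0 assms by (subst u_minus_equation_iff) (auto simp: field_simps)
  have uniq: "u = 1 - 1 / a" if "?P u" for u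
  proof -
    let ?b = "1 / (1 - u)"
    have b: "0 < ?b" "?b \<le> 1" "tangent_line p ?b 1 = t powr p"
      using that u_minus_equation_iff[of p u t] assms by (auto simp: field_simps)
    then have "?b = a"
      using tangent_line_strict_mono[of p a ?b 1] tangent_line_strict_mono[of p ?b a 1] a a0 assms
      by (cases a ?b rule: linorder_cases) auto
    then show ?thesis
      using a0 by (auto simp: field_simps)
  qed
  have P: "?P (u_minus p t)"
    unfolding u_minus_def using ex uniq by (rule theI)
  then show "u_minus p t \<le> 0"
    by blast
  then show "tangent_line p (1 / (1 - u_minus p t)) 1 = t powr p"
    using P u_minus_equation_iff[of p "u_minus p t" t] assms by blast
qed

text \<open>
  The left point of tangency for \<open>(x, z)\<close>: homogeneity reduces it to abscissa \<open>1\<close>, where the parameter is the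
  value of \<open>u\<^sub>p\<^sup>-\<close> at \<open>z\<^sup>1\<^sup>/\<^sup>p / x\<close>.
\<close>
definition tangency :: "real \<Rightarrow> real \<Rightarrow> real \<Rightarrow> real" where
  "tangency p x z = x / (1 - u_minus p (z powr (1 / p) / x))"

lemma tangency:
  assumes "1 < p" "0 < x" "0 < z" "z \<le> x powr p"
  shows "0 < tangency p x z" "tangency p x z \<le> x" "tangent_line p (tangency p x z) x = z"
proof -
  let ?t = "z powr (1 / p) / x"
  have "z powr (1 / p) \<le> (x powr p) powr (1 / p)"
    using assms by (intro powr_mono2) auto
  then have t: "0 < ?t" "?t \<le> 1"
    using assms by (auto simp: powr_powr)
  note u = u_minus_solves[OF assms(1) t]
  show "0 < tangency p x z" "tangency p x z \<le> x"
    using u assms by (auto simp: tangency_def field_simps mult_le_0_iff)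
  have "tangent_line p (tangency p x z) x = x powr p * ?t powr p"
    using u assms tangent_line_scale[of x "1 / (1 - u_minus p ?t)" p 1] by (simp add: tangency_def)
  also have "\<dots> = z"
    using assms by (simp add: powr_divide powr_powr)
  finally show "tangent_line p (tangency p x z) x = z" .
qed

lemma tangent_line_tangency:
  assumes "1 < p" "0 < x" "0 < z" "z \<le> x powr p"
  defines "u \<equiv> u_minus p (z powr (1 / p) / x)"
  shows "tangent_line e (tangency p x z) x = x powr e * ((1 - e * u) * (1 - u) powr (- e))"
proof -
  have "u \<le> 0"
    using tangency(1,2)[OF assms(1-4)] assms(2) unfolding tangency_def u_def
    by (auto simp: field_simps mult_le_0_iff zero_less_divide_iff)
  then show ?thesis
    using tangent_line_scale[of x "1 / (1 - u)" e 1] tangent_line_unit[of u e] assms(2)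
    by (simp add: tangency_def u_def)
qed

text \<open>
  The function that is affine along each tangent to \<open>t\<^sup>p\<close>, to the right of the point of tangency, and has boundary
  values \<open>x\<^sup>q\<close> on the curve \<open>z = x\<^sup>p\<close>.
\<close>
definition envelope :: "real \<Rightarrow> real \<Rightarrow> real \<Rightarrow> real \<Rightarrow> real" where
  "envelope p q x z = tangent_line q (tangency p x z) x"

text \<open>
  The support function at the midpoint \<open>P\<close> is affine, agrees with the envelope at \<open>P\<close> and dominates it at both
  endpoints. For the right endpoint this is clear as \<open>a \<le> x \<le> x2\<close>. If \<open>a\<close> exceeds \<open>x1\<close>, the chord
  from the left endpoint to \<open>P\<close> is under the curve at abscissa \<open>a\<close>, where the tangent touches the curve; since
  chord and tangent meet at \<open>P\<close>, the left endpoint is below the tangent. The midpoint is required to be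
  strictly under the curve, because for \<open>a = x\<close> touching at abscissa \<open>a\<close> says nothing about the left endpoint.
\<close>
lemma envelope_midpoint:
  assumes "1 < p" "q < 0" "0 < x1" "x1 \<le> x2"
    and z1: "0 < z1" "z1 \<le> x1 powr p" and z2: "0 < z2" "z2 \<le> x2 powr p"
    and z: "(z1 + z2) / 2 < ((x1 + x2) / 2) powr p"
    and chord: "\<And>l. 0 \<le> l \<Longrightarrow> l \<le> 1 \<Longrightarrow>
      (1 - l) * z1 + l * ((z1 + z2) / 2) \<le> ((1 - l) * x1 + l * ((x1 + x2) / 2)) powr p"
  shows "envelope p q x1 z1 + envelope p q x2 z2 \<le> 2 * envelope p q ((x1 + x2) / 2) ((z1 + z2) / 2)"
proof -
  let ?x = "(x1 + x2) / 2" and ?z = "(z1 + z2) / 2"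
  define a where "a = tangency p ?x ?z"
  have a: "0 < a" "a \<le> ?x" "tangent_line p a ?x = ?z"
    unfolding a_def using z z1 z2 assms(1,3,4) by (intro tangency less_imp_le[OF z]; simp)+
  have "a \<noteq> ?x"
    using a(3) z tangent_line_self[OF a(1), of p] by (metis less_irrefl)
  then have "a < ?x" using a by simp
  have "a \<le> x1 \<or> z1 \<le> tangent_line p a x1"
  proof (cases "a \<le> x1")
    case False
    \<comment> \<open>The position of abscissa \<open>a\<close> on the chord from the left endpoint to the midpoint.\<close>
    define l where "l = (a - x1) / (?x - x1)"
    have l: "0 \<le> l" "l < 1"
      using False \<open>a < ?x\<close> by (auto simp: l_def)
    have "l * (?x - x1) = a - x1"
      using False \<open>a < ?x\<close> by (simp add: l_def)
    then have l_a: "(1 - l) * x1 + l * ?x = a"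
      by argo
    have "(1 - l) * z1 + l * ?z \<le> a powr p"
      using chord[of l] l l_a by simp
    also have "a powr p = (1 - l) * tangent_line p a x1 + l * ?z"
      using tangent_line_convex_comb[of p a l x1 ?x] l_a a tangent_line_self[OF a(1), of p] by simp
    finally have "(1 - l) * z1 \<le> (1 - l) * tangent_line p a x1"
      by simp
    then show ?thesis
      using l by simp
  qed auto
  then have "envelope p q x1 z1 \<le> support_line p q a x1 z1"
    unfolding envelope_def using assms a tangency[of p x1 z1]
    by (intro tangent_value_le_support_line) auto
  moreover have "envelope p q x2 z2 \<le> support_line p q a x2 z2"
    unfolding envelope_def using assms a tangency[of p x2 z2]
    by (intro tangent_value_le_support_line) auto
  ultimately have "envelope p q x1 z1 + envelope p q x2 z2 \<le> 2 * support_line p q a ?x ?z"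
    by (simp only: support_line_midpoint)
  also have "support_line p q a ?x ?z = envelope p q ?x ?z"
    by (simp only: support_line_def envelope_def a) (simp add: a_def)
  finally show ?thesis .
qed

lemma envelope_mono:
  assumes "1 < p" "q < 0" "0 < x" "0 < z'" "z' \<le> z" "z \<le> x powr p"
  shows "envelope p q x z' \<le> envelope p q x z"
proof -
  let ?a = "tangency p x z" and ?b = "tangency p x z'"
  have a: "0 < ?a" "?a \<le> x" "tangent_line p ?a x = z"
    using assms by (auto intro!: tangency)
  have b: "0 < ?b" "?b \<le> x" "tangent_line p ?b x = z'"
    using assms by (auto intro!: tangency)
  \<comment> \<open>A higher point has its tangency further to the right.\<close>
  have "?b \<le> ?a"
    using tangent_line_strict_mono[of p ?a ?b x] a b assms by fastforce
  then show ?thesis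
    unfolding envelope_def using a b assms by (intro tangent_line_mono_neg) auto
qed

section \<open>Chords of a power function\<close>

text \<open>
  The largest ratio of the chord of \<open>t\<^sup>p\<close> over \<open>[1, Q]\<close> to \<open>t\<^sup>p\<close>, which is \<open>(\<epsilon> / \<delta>)\<^sup>p\<close>.
\<close>
definition chord_excess :: "real \<Rightarrow> real \<Rightarrow> real" where
  "chord_excess p Q = (H_const p Q / p) powr p * ((p - 1) / (H_const p Q - 1)) powr (p - 1)"

lemma H_const_gt_1:
  assumes "1 < p" "1 < Q"
  shows "1 < H_const p Q"
  using assms powr_less_mono[of 1 p Q] by (simp add: H_const_def)

text \<open>
  The ratio of the chord to the curve is largest at \<open>t = b\<close>. There the curve scaled by that ratio touches the line through
  the endpoints of the chord, so this line is a tangent of the scaled curve.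
\<close>
lemma chord_line_eq_tangent_line:
  assumes "1 < p" "1 < Q"
  defines "b \<equiv> p * (H_const p Q - 1) / ((p - 1) * H_const p Q)"
  shows "0 < b" and "1 + H_const p Q * (t - 1) = chord_excess p Q * tangent_line p b t"
proof -
  define H where "H = H_const p Q"
  have H: "1 < H"
    using H_const_gt_1 assms by (simp add: H_def)
  have b: "b = p * (H - 1) / ((p - 1) * H)"
    by (simp add: b_def H_def)
  show b0: "0 < b"
    unfolding b using H assms(1) by simp
  have k: "chord_excess p Q = (H / p) * b powr (1 - p)"
  proof -
    have "b powr (1 - p) = (H / p * ((p - 1) / (H - 1))) powr (p - 1)"
      using H assms(1) by (subst minus_diff_eq[symmetric], subst powr_minus)
        (simp add: b inverse_powr[symmetric] powr_divide powr_mult field_simps)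
    also have "\<dots> = (H / p) powr (p - 1) * ((p - 1) / (H - 1)) powr (p - 1)"
      using H assms(1) by (subst powr_mult) auto
    finally have "H / p * b powr (1 - p) = H / p * (H / p) powr (p - 1) * ((p - 1) / (H - 1)) powr (p - 1)"
      by simp
    also have "H / p * (H / p) powr (p - 1) = (H / p) powr p"
      using H assms(1) by (subst powr_mult_base) auto
    finally show ?thesis
      by (simp add: chord_excess_def H_def[symmetric])
  qed
  have "tangent_line p b t = b powr (p - 1) * ((1 - p) * b + p * t)"
    using b0 by (simp add: tangent_line_def powr_diff field_simps)
  moreover have "b powr (1 - p) * b powr (p - 1) = 1"
    using b0 by (simp flip: powr_add)
  then have "b powr (1 - p) * (b powr (p - 1) * y) = y" for y
    by (simp flip: mult.assoc)
  ultimately have "chord_excess p Q * tangent_line p b t = H / p * ((1 - p) * b + p * t)"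
    by (simp only: k mult.assoc)
  also have "\<dots> = 1 + H * (t - 1)"
    using H assms(1) by (simp add: b field_simps)
  finally show "1 + H_const p Q * (t - 1) = chord_excess p Q * tangent_line p b t"
    by (simp add: H_def)
qed

text \<open>
  The chord meets the curve at \<open>1\<close> and at \<open>Q\<close>, and is tangent to the scaled curve at a single point. At the
  endpoint different from that point the scaled curve is strictly above the original one.
\<close>
lemma chord_excess_gt_1:
  assumes "1 < p" "1 < Q"
  shows "1 < chord_excess p Q"
proof -
  define b where "b = p * (H_const p Q - 1) / ((p - 1) * H_const p Q)"
  note b = chord_line_eq_tangent_line[OF assms, folded b_def]
  have k0: "0 < chord_excess p Q"
    using H_const_gt_1[OF assms] assms by (simp add: chord_excess_def)
  show ?thesis
  proof (cases "b = 1")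
    case True
    have "Q powr p = 1 + H_const p Q * (Q - 1)"
      using assms by (simp add: H_const_def)
    also have "\<dots> < chord_excess p Q * Q powr p"
      unfolding b(2) using True tangent_line_less_powr[of p b Q] k0 assms by simp
    finally show ?thesis
      using assms by simp
  next
    case False
    have "1 = chord_excess p Q * tangent_line p b 1"
      using b(2)[of 1] by simp
    also have "\<dots> < chord_excess p Q"
      using False tangent_line_less_powr[of p b 1] k0 assms b(1) by simp
    finally show ?thesis .
  qed
qed

lemma powr_convex_comb:
  fixes p x x' l :: real
  assumes "1 < p" "0 < x" "0 < x'" "0 \<le> l" "l \<le> 1"
  shows "((1 - l) * x + l * x') powr p \<le> (1 - l) * x powr p + l * x' powr p"
proof -
  let ?a = "(1 - l) * x + l * x'"
  have a: "0 < ?a"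
    using assms add_nonneg_pos[of "(1 - l) * x" "l * x'"] by (cases "l = 0") simp_all
  have "?a powr p = (1 - l) * tangent_line p ?a x + l * tangent_line p ?a x'"
    using tangent_line_self[OF a, of p] tangent_line_convex_comb[of p ?a l x x'] by simp
  also have "\<dots> \<le> (1 - l) * x powr p + l * x' powr p"
    using a assms by (intro add_mono mult_left_mono tangent_line_le_powr) auto
  finally show ?thesis .
qed

text \<open>
  By scaling \<open>x = 1\<close>. Chords over \<open>[1, R]\<close> with \<open>R \<le> Q\<close> are below the line through \<open>1\<close> and \<open>Q\<close> by
  convexity.
\<close>
lemma chord_le_chord_excess:
  assumes "1 < p" "1 < Q" "0 < x" "x \<le> x'" "x' \<le> Q * x" "0 \<le> l" "l \<le> 1"
  shows "(1 - l) * x powr p + l * x' powr p \<le> chord_excess p Q * ((1 - l) * x + l * x') powr p"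
proof -
  define b where "b = p * (H_const p Q - 1) / ((p - 1) * H_const p Q)"
  note b = chord_line_eq_tangent_line[OF assms(1,2), folded b_def]
  define R where "R = x' / x"
  have R: "1 \<le> R" "R \<le> Q" "x' = x * R"
    using assms by (auto simp: R_def field_simps)
  let ?t = "(1 - l) * 1 + l * R"
  have t: "?t \<ge> 1"
    using assms R mult_left_mono[of 1 R l] by (simp add: algebra_simps)
  have below: "R powr p \<le> 1 + H_const p Q * (R - 1)"
  proof -
    define m where "m = (R - 1) / (Q - 1)"
    have "m * (Q - 1) = R - 1"
      using assms by (simp add: m_def)
    then have "R = (1 - m) * 1 + m * Q"
      by argo
    moreover have "0 \<le> m" "m \<le> 1"
      using R assms by (auto simp: m_def)
    ultimately have m: "0 \<le> m" "m \<le> 1" "R = (1 - m) * 1 + m * Q"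
      by blast+
    have "R powr p \<le> (1 - m) * 1 powr p + m * Q powr p"
      using powr_convex_comb[of p 1 Q m] m assms by simp
    also have "\<dots> = 1 + H_const p Q * (R - 1)"
      by (simp add: H_const_def m_def algebra_simps diff_divide_distrib)
    finally show ?thesis .
  qed
  have "(1 - l) * 1 + l * R powr p \<le> (1 - l) * 1 + l * (1 + H_const p Q * (R - 1))"
    using below assms by (intro add_mono mult_left_mono) auto
  also have "\<dots> = 1 + H_const p Q * (?t - 1)"
    by (simp add: algebra_simps)
  also have "\<dots> \<le> chord_excess p Q * ?t powr p"
    unfolding b(2) using b(1) t assms tangent_line_le_powr[of p b ?t] chord_excess_gt_1[OF assms(1,2)]
    by (intro mult_left_mono) auto
  finally have "x powr p * ((1 - l) * 1 + l * R powr p) \<le> x powr p * (chord_excess p Q * ?t powr p)"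
    by (rule mult_left_mono) auto
  moreover have "(x * ?t) powr p = x powr p * ?t powr p"
    by (rule powr_mult)
  ultimately show ?thesis
    using R assms by (simp add: powr_mult algebra_simps)
qed

lemma eps_const_powr:
  assumes "1 < p" "1 < Q" "0 < \<delta>"
  shows "0 < eps_const p \<delta> Q" "eps_const p \<delta> Q powr p = chord_excess p Q * \<delta> powr p"
proof -
  have "1 < H_const p Q"
    using H_const_gt_1 assms by blast
  then have pos: "0 < H_const p Q / p" "0 < (p - 1) / (H_const p Q - 1)"
    using assms by auto
  then show "0 < eps_const p \<delta> Q"
    using assms unfolding eps_const_def by (intro mult_pos_pos) auto
  have "eps_const p \<delta> Q powr p = (H_const p Q / p) powr p
      * (((p - 1) / (H_const p Q - 1)) powr ((p - 1) / p)) powr p * \<delta> powr p"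
    unfolding eps_const_def using pos assms by (simp only: powr_mult mult_nonneg_nonneg powr_ge_zero less_imp_le)
  then show "eps_const p \<delta> Q powr p = chord_excess p Q * \<delta> powr p"
    unfolding chord_excess_def powr_powr using assms by simp
qed

text \<open>
  The left endpoint can be either of the two points, since the halves of a dyadic interval may carry their
  means in any order.
\<close>
lemma envelope_midpoint_of_ratio:
  assumes "1 < p" "q < 0" "1 < Q" "0 < x1" "0 < x2" "0 < z1" "0 < z2"
    and z1: "chord_excess p Q * z1 \<le> x1 powr p" and z2: "chord_excess p Q * z2 \<le> x2 powr p"
    and z: "chord_excess p Q * ((z1 + z2) / 2) \<le> ((x1 + x2) / 2) powr p"
    and x: "(x1 + x2) / 2 \<le> Q * x1" "(x1 + x2) / 2 \<le> Q * x2"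
  shows "envelope p q x1 z1 + envelope p q x2 z2 \<le> 2 * envelope p q ((x1 + x2) / 2) ((z1 + z2) / 2)"
proof -
  have k: "1 < chord_excess p Q"
    using chord_excess_gt_1 assms by blast
  \<comment> \<open>The strictness that \<open>envelope_midpoint\<close> needs comes from the factor \<open>chord_excess p Q > 1\<close>.\<close>
  have less: "v < u powr p" if "chord_excess p Q * v \<le> u powr p" "0 < v" for u v
    using mult_strict_right_mono[OF k, of v] that by linarith
  have chord: "(1 - l) * v + l * v' \<le> ((1 - l) * u + l * u') powr p"
    if "0 < u" "u \<le> u'" "u' \<le> Q * u" "0 \<le> l" "l \<le> 1"
      "chord_excess p Q * v \<le> u powr p" "chord_excess p Q * v' \<le> u' powr p" for u u' v v' l
  proof -
    have "chord_excess p Q * ((1 - l) * v + l * v') = (1 - l) * (chord_excess p Q * v) + l * (chord_excess p Q * v')"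
      by (simp add: algebra_simps)
    also have "\<dots> \<le> (1 - l) * u powr p + l * u' powr p"
      using that by (intro add_mono mult_left_mono) auto
    also have "\<dots> \<le> chord_excess p Q * ((1 - l) * u + l * u') powr p"
      using that assms by (intro chord_le_chord_excess) auto
    finally show ?thesis
      using k by simp
  qed
  have main: "envelope p q u v + envelope p q u' v' \<le> 2 * envelope p q ((u + u') / 2) ((v + v') / 2)"
    if "0 < u" "u \<le> u'" "0 < v" "0 < v'" "(u + u') / 2 \<le> Q * u"
      "chord_excess p Q * v \<le> u powr p" "chord_excess p Q * v' \<le> u' powr p"
      "chord_excess p Q * ((v + v') / 2) \<le> ((u + u') / 2) powr p" for u u' v v'
  proof (rule envelope_midpoint)
    fix l :: real assume "0 \<le> l" "l \<le> 1"
    then show "(1 - l) * v + l * ((v + v') / 2) \<le> ((1 - l) * u + l * ((u + u') / 2)) powr p"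
      using that by (intro chord) auto
  qed (use that assms less in \<open>auto intro!: less_imp_le simp del: divide_less_eq_numeral1\<close>)
  show ?thesis
  proof (cases "x1 \<le> x2")
    case True
    then show ?thesis
      using assms by (intro main) auto
  next
    case False
    then have "envelope p q x2 z2 + envelope p q x1 z1 \<le> 2 * envelope p q ((x2 + x1) / 2) ((z2 + z1) / 2)"
      using assms by (intro main) (auto simp: add.commute)
    then show ?thesis
      by (simp add: add.commute)
  qed
qed

lemma eps_const_gt_1:
  assumes "1 < p" "1 < Q" "1 < \<delta>"
  shows "1 < eps_const p \<delta> Q"
proof -
  have "1 * 1 < chord_excess p Q * \<delta> powr p"
    using chord_excess_gt_1[of p Q] assms gr_one_powr[of \<delta> p] by (intro mult_strict_mono) auto
  then have "1 < eps_const p \<delta> Q powr p"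
    using eps_const_powr[of p Q \<delta>] assms by simp
  then show ?thesis
    using powr_le1[of p "eps_const p \<delta> Q"] eps_const_powr(1)[of p Q \<delta>] assms by force
qed

lemma s_minus_neg:
  assumes "1 < p" "1 < \<epsilon>" "1 / s_minus p \<epsilon> < q" "q < 0"
  shows "s_minus p \<epsilon> < 0" "q * s_minus p \<epsilon> < 1"
proof -
  have "s_minus p \<epsilon> \<le> 0"
    using u_minus_solves(1)[of p "1 / \<epsilon>"] assms by (simp add: s_minus_def)
  moreover have "s_minus p \<epsilon> \<noteq> 0"
    using assms by auto
  ultimately show "s_minus p \<epsilon> < 0" by simp
  then show "q * s_minus p \<epsilon> < 1"
    using assms by (simp add: field_simps)
qed

text \<open>
  On the lower boundary \<open>y = x\<^sup>p\<close> the tangent parameter is \<open>s\<close> and both sides agree; the envelope grows with \<open>y\<close>.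
  This comparison with \<open>x\<^sup>q\<close> replaces continuity up to the boundary in the limiting argument.
\<close>
lemma normalized_envelope_lower:
  assumes "1 < p" "q < 0" "1 < \<epsilon>" "0 < x" "x powr p \<le> y" "y \<le> \<epsilon> powr p * x powr p"
  defines "s \<equiv> s_minus p \<epsilon>"
  assumes "q * s < 1" "s < 0"
  shows "x powr q \<le> (1 - s) powr q / (1 - q * s) * envelope p q x (y / \<epsilon> powr p)"
proof -
  have root: "(x powr p / \<epsilon> powr p) powr (1 / p) / x = 1 / \<epsilon>"
    using assms by (simp add: powr_divide powr_powr)
  have "x powr p / \<epsilon> powr p \<le> x powr p"
    using assms ge_one_powr_ge_zero[of \<epsilon> p] by (simp add: divide_le_eq)
  then have "envelope p q x (x powr p / \<epsilon> powr p) = x powr q * ((1 - q * s) * (1 - s) powr (- q))"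
    using assms tangent_line_tangency[of p x "x powr p / \<epsilon> powr p" q]
    by (simp add: envelope_def root s_minus_def)
  moreover have "envelope p q x (x powr p / \<epsilon> powr p) \<le> envelope p q x (y / \<epsilon> powr p)"
    using assms by (intro envelope_mono) (auto simp: divide_le_eq divide_right_mono mult.commute)
  ultimately have "x powr q * ((1 - q * s) * (1 - s) powr (- q)) \<le> envelope p q x (y / \<epsilon> powr p)"
    by simp
  then have "(1 - s) powr q / (1 - q * s) * (x powr q * ((1 - q * s) * (1 - s) powr (- q)))
      \<le> (1 - s) powr q / (1 - q * s) * envelope p q x (y / \<epsilon> powr p)"
    using assms by (intro mult_left_mono) auto
  also have "(1 - s) powr q / (1 - q * s) * (x powr q * ((1 - q * s) * (1 - s) powr (- q))) = x powr q"
    using assms by (simp add: powr_minus field_simps)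
  finally show ?thesis .
qed

section \<open>Dyadic intervals\<close>

definition dyadic_point :: "int \<Rightarrow> int \<Rightarrow> real" where
  "dyadic_point k n = of_int n * 2 powi (- k)"

definition dyadic :: "int \<Rightarrow> int \<Rightarrow> real set" where
  "dyadic k n = {dyadic_point k n..dyadic_point k (n + 1)}"

lemma dyadic_intervals_eq: "dyadic_intervals = {dyadic k n | k n. True}"
  by (auto simp: dyadic_intervals_def dyadic_def dyadic_point_def)

lemma dyadic_in_dyadic_intervals: "dyadic k n \<in> dyadic_intervals"
  by (auto simp: dyadic_intervals_eq)

lemma dyadic_point_refine: "dyadic_point (k + 1) (2 * n) = dyadic_point k n"
  by (simp add: dyadic_point_def power_int_diff)

lemma dyadic_point_next: "dyadic_point k (n + 1) = dyadic_point k n + 2 powi (- k)"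
  by (simp add: dyadic_point_def algebra_simps)

lemma dyadic_point_less: "dyadic_point k n < dyadic_point k (n + 1)"
  by (simp add: dyadic_point_next)

lemma dyadic_point_mono: "m \<le> n \<Longrightarrow> dyadic_point k m \<le> dyadic_point k n"
  by (simp add: dyadic_point_def mult_right_mono)

lemma dyadic_point_mono_iff: "dyadic_point k m \<le> dyadic_point k n \<longleftrightarrow> m \<le> n"
  by (simp add: dyadic_point_def)

lemma dyadic_point_refine_pow: "dyadic_point (k + int i) (2 ^ i * n) = dyadic_point k n"
proof (induction i)
  case (Suc i)
  have "dyadic_point (k + int (Suc i)) (2 ^ Suc i * n)
      = dyadic_point ((k + int i) + 1) (2 * (2 ^ i * n))"
    by (simp add: add_ac mult.assoc)
  then show ?case
    by (simp only: dyadic_point_refine Suc)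
qed simp

lemma dyadic_halves:
  "dyadic (k + 1) (2 * n) = {dyadic_point k n..dyadic_point (k + 1) (2 * n + 1)}"
  "dyadic (k + 1) (2 * n + 1) = {dyadic_point (k + 1) (2 * n + 1)..dyadic_point k (n + 1)}"
  using dyadic_point_refine[of k n] dyadic_point_refine[of k "n + 1"]
  by (simp_all add: dyadic_def add.commute)

lemma dyadic_midpoint:
  "dyadic_point k n < dyadic_point (k + 1) (2 * n + 1)"
  "dyadic_point (k + 1) (2 * n + 1) < dyadic_point k (n + 1)"
  using dyadic_point_less[of "k + 1" "2 * n"] dyadic_point_less[of "k + 1" "2 * n + 1"]
    dyadic_point_refine[of k n] dyadic_point_refine[of k "n + 1"]
  by (simp_all add: add.commute)

lemma dyadic_half_subset: "dyadic (k + 1) (2 * n) \<subset> dyadic k n" "dyadic (k + 1) (2 * n + 1) \<subset> dyadic k n"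
  unfolding dyadic_halves using dyadic_midpoint[of k n] by (auto simp: dyadic_def)

text \<open>
  A dyadic interval that strictly contains \<open>dyadic (k + 1) m\<close> has a generation \<open>j \<le> k\<close>. Its endpoints are
  then even multiples of the mesh of generation \<open>k + 1\<close>, so it cannot separate the two halves of an interval of
  generation \<open>k\<close>.
\<close>
lemma dyadic_parent_dyadic: "dyadic_parent (dyadic (k + 1) m) = dyadic k (m div 2)"
  unfolding dyadic_parent_def
proof (rule Least_equality)
  have "m = 2 * (m div 2) \<or> m = 2 * (m div 2) + 1"
    by presburger
  then have "dyadic (k + 1) m \<subset> dyadic k (m div 2)"
    using dyadic_half_subset[of k "m div 2"] by auto
  then show "dyadic k (m div 2) \<in> dyadic_intervals \<and> dyadic (k + 1) m \<subset> dyadic k (m div 2)"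
    by (simp add: dyadic_in_dyadic_intervals)
next
  fix K assume "K \<in> dyadic_intervals \<and> dyadic (k + 1) m \<subset> K"
  then obtain j n where K: "K = dyadic j n" and sub: "dyadic (k + 1) m \<subset> dyadic j n"
    by (auto simp: dyadic_intervals_eq)
  have ends: "dyadic_point j n \<le> dyadic_point (k + 1) m"
      "dyadic_point (k + 1) (m + 1) \<le> dyadic_point j (n + 1)"
    using sub dyadic_point_less[of "k + 1" m] by (auto simp: dyadic_def)
  have "j \<le> k"
  proof (rule ccontr)
    assume "\<not> j \<le> k"
    then have "2 powi (- j) \<le> (2 :: real) powi (- (k + 1))"
      by (intro power_int_increasing) auto
    then have "dyadic (k + 1) m = dyadic j n"
      using ends by (simp add: dyadic_def dyadic_point_next)
    then show False using sub by simp
  qed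
  define i where "i = nat (k + 1 - j)"
  obtain i' where i': "i = Suc i'"
    using \<open>j \<le> k\<close> by (cases i) (auto simp: i_def)
  have kj: "k + 1 = j + int i"
    using \<open>j \<le> k\<close> by (simp add: i_def)
  have kj': "k = j + int i'"
    using kj i' by simp
  have "2 ^ i * n \<le> m" "m + 1 \<le> 2 ^ i * (n + 1)"
    using ends unfolding kj
    by (simp_all only: dyadic_point_refine_pow[of j i, symmetric] dyadic_point_mono_iff)
  then have "2 * (2 ^ i' * n) \<le> m" "m + 1 \<le> 2 * (2 ^ i' * (n + 1))"
    by (simp_all add: i' mult.assoc)
  then have "2 ^ i' * n \<le> m div 2" "m div 2 + 1 \<le> 2 ^ i' * (n + 1)"
    by linarith+
  then have "dyadic_point j n \<le> dyadic_point k (m div 2)"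
      "dyadic_point k (m div 2 + 1) \<le> dyadic_point j (n + 1)"
    using dyadic_point_refine_pow[of j i' n] dyadic_point_refine_pow[of j i' "n + 1"]
    by (metis dyadic_point_mono kj')+
  then show "dyadic k (m div 2) \<le> K"
    by (simp add: K dyadic_def)
qed

definition dyadic_avg :: "(real \<Rightarrow> real) \<Rightarrow> int \<Rightarrow> int \<Rightarrow> real" where
  "dyadic_avg f k n = integral (dyadic k n) f / 2 powi (- k)"

lemma dyadic_avg_halves:
  assumes "f integrable_on dyadic k n"
  shows "dyadic_avg f k n = (dyadic_avg f (k + 1) (2 * n) + dyadic_avg f (k + 1) (2 * n + 1)) / 2"
proof -
  have "integral (dyadic k n) f = integral (dyadic (k + 1) (2 * n)) f + integral (dyadic (k + 1) (2 * n + 1)) f"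
    unfolding dyadic_halves unfolding dyadic_def using assms dyadic_midpoint[of k n]
    by (subst Henstock_Kurzweil_Integration.integral_combine) (auto simp: dyadic_def)
  then show ?thesis
    by (simp add: dyadic_avg_def power_int_diff add_divide_distrib)
qed

lemma dyadic_contains_floor:
  "t \<in> {dyadic_point k \<lfloor>t * 2 powi k\<rfloor>..<dyadic_point k (\<lfloor>t * 2 powi k\<rfloor> + 1)}"
  by (simp add: dyadic_point_def power_int_minus divide_inverse[symmetric] divide_le_eq less_divide_eq)

lemma dyadic_floor_eq:
  assumes "t \<in> {dyadic_point k n..<dyadic_point k (n + 1)}"
  shows "\<lfloor>t * 2 powi k\<rfloor> = n"
  using assms by (intro floor_unique)
    (auto simp: dyadic_point_def power_int_minus divide_inverse[symmetric] divide_le_eq less_divide_eq)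

lemma borel_measurable_dyadic_step:
  fixes g :: "int \<Rightarrow> int \<Rightarrow> real"
  shows "(\<lambda>t::real. ennreal (g k \<lfloor>t * 2 powi k\<rfloor>)) \<in> borel_measurable lebesgue"
proof -
  have "(\<lambda>t::real. \<lfloor>t * 2 powi k\<rfloor>) \<in> measurable borel (count_space UNIV)"
    by measurable
  then have "(\<lambda>t::real. ennreal (g k \<lfloor>t * 2 powi k\<rfloor>)) \<in> borel_measurable borel"
    by measurable
  then show ?thesis
    by (simp add: measurable_completion)
qed

text \<open>
  The induction step of the Bellman function method: a quantity \<open>b\<close> that is midpoint concave along dyadic
  splittings dominates the averages of \<open>g\<close> over all later generations. Half-open intervals are used since on
  them the index \<open>\<lfloor>t 2\<^sup>k\<rfloor>\<close> of the dyadic interval that contains \<open>t\<close> is exactly constant.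
\<close>
lemma nn_integral_dyadic_step_le:
  fixes g b :: "int \<Rightarrow> int \<Rightarrow> real"
  assumes le: "\<And>k n. dyadic k n \<subseteq> J \<Longrightarrow> g k n \<le> b k n"
    and nonneg: "\<And>k n. dyadic k n \<subseteq> J \<Longrightarrow> 0 \<le> b k n"
    and halves: "\<And>k n. dyadic k n \<subseteq> J \<Longrightarrow> b (k + 1) (2 * n) + b (k + 1) (2 * n + 1) \<le> 2 * b k n"
    and J: "dyadic k n \<subseteq> J"
  shows "(\<integral>\<^sup>+t\<in>{dyadic_point k n..<dyadic_point k (n + 1)}.
      ennreal (g (k + int m) \<lfloor>t * 2 powi (k + int m)\<rfloor>) \<partial>lebesgue) \<le> ennreal (2 powi (- k) * b k n)"
  using J
proof (induction m arbitrary: k n)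
  case 0
  have "(\<integral>\<^sup>+t\<in>{dyadic_point k n..<dyadic_point k (n + 1)}.
      ennreal (g (k + int 0) \<lfloor>t * 2 powi (k + int 0)\<rfloor>) \<partial>lebesgue)
    = (\<integral>\<^sup>+t. ennreal (g k n) * indicator {dyadic_point k n..<dyadic_point k (n + 1)} t \<partial>lebesgue)"
    using dyadic_floor_eq[of _ k n] by (intro nn_integral_cong) (simp split: split_indicator)
  also have "\<dots> = ennreal (g k n) * ennreal (2 powi (- k))"
    using dyadic_point_less[of k n]
    by (subst nn_integral_cmult_indicator) (auto simp: dyadic_point_next)
  also have "\<dots> \<le> ennreal (b k n) * ennreal (2 powi (- k))"
    using le[OF 0] by (intro mult_right_mono ennreal_leI) auto
  also have "\<dots> = ennreal (2 powi (- k) * b k n)"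
    using nonneg[OF 0] by (simp add: ennreal_mult mult.commute)
  finally show ?case .
next
  case (Suc m)
  let ?F = "\<lambda>t::real. ennreal (g (k + int (Suc m)) \<lfloor>t * 2 powi (k + int (Suc m))\<rfloor>)"
  let ?c = "dyadic_point (k + 1) (2 * n + 1)"
  have sub: "dyadic (k + 1) (2 * n) \<subseteq> J" "dyadic (k + 1) (2 * n + 1) \<subseteq> J"
    using dyadic_half_subset[of k n] Suc.prems by auto
  have meas: "?F \<in> borel_measurable lebesgue"
    by (rule borel_measurable_dyadic_step)
  have split: "{dyadic_point k n..<dyadic_point k (n + 1)}
      = {dyadic_point k n..<?c} \<union> {?c..<dyadic_point k (n + 1)}"
    using dyadic_midpoint[of k n] by auto
  have IH: "(\<integral>\<^sup>+t\<in>{dyadic_point (k + 1) l..<dyadic_point (k + 1) (l + 1)}. ?F t \<partial>lebesgue)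
      \<le> ennreal (2 powi (- (k + 1)) * b (k + 1) l)" if "dyadic (k + 1) l \<subseteq> J" for l
    using Suc.IH[OF that] by (simp add: add_ac)
  have ends: "dyadic_point (k + 1) (2 * n) = dyadic_point k n"
      "dyadic_point (k + 1) (2 * n + 1 + 1) = dyadic_point k (n + 1)"
    using dyadic_point_refine[of k n] dyadic_point_refine[of k "n + 1"] by (simp_all add: add.commute)
  have "(\<integral>\<^sup>+t\<in>{dyadic_point k n..<dyadic_point k (n + 1)}. ?F t \<partial>lebesgue)
    = (\<integral>\<^sup>+t\<in>{dyadic_point k n..<?c}. ?F t \<partial>lebesgue) + (\<integral>\<^sup>+t\<in>{?c..<dyadic_point k (n + 1)}. ?F t \<partial>lebesgue)"
    unfolding split by (rule nn_integral_disjoint_pair[OF meas]) auto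
  also have "\<dots> \<le> ennreal (2 powi (- (k + 1)) * b (k + 1) (2 * n)) + ennreal (2 powi (- (k + 1)) * b (k + 1) (2 * n + 1))"
    using IH[OF sub(1)] IH[OF sub(2)] unfolding ends by (rule add_mono)
  also have "\<dots> = ennreal (2 powi (- (k + 1)) * (b (k + 1) (2 * n) + b (k + 1) (2 * n + 1)))"
    using nonneg[OF sub(1)] nonneg[OF sub(2)] by (simp add: distrib_left)
  also have "\<dots> \<le> ennreal (2 powi (- (k + 1)) * (2 * b k n))"
    using halves[OF Suc.prems] by (intro ennreal_leI mult_left_mono) auto
  also have "\<dots> = ennreal (2 powi (- k) * b k n)"
    by (simp add: power_int_diff)
  finally show ?case .
qed

section \<open>Differentiation of integrals over shrinking intervals\<close>

lemma right_averages_tendsto: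
  fixes f :: "real \<Rightarrow> real"
  assumes "\<And>a b. f integrable_on {a..b}"
  obtains N where "N \<in> null_sets lebesgue"
    and "\<And>t e. t \<notin> N \<Longrightarrow> 0 < e \<Longrightarrow>
      \<exists>d>0. \<forall>h. 0 < h \<and> h < d \<longrightarrow> \<bar>integral {t..t + h} f / h - f t\<bar> < e"
proof -
  have "\<And>a b. f integrable_on cbox a b"
    using assms by (simp add: box_real)
  then obtain N where N: "negligible N" and lim: "\<And>x e. \<lbrakk>x \<notin> N; 0 < e\<rbrakk> \<Longrightarrow>
      \<exists>d>0. \<forall>h. 0 < h \<and> h < d \<longrightarrow> norm (integral (cbox x (x + h *\<^sub>R One)) f /\<^sub>R h ^ DIM(real) - f x) < e"
    by (rule integrable_ccontinuous_explicit) blast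
  have eq: "norm (integral (cbox x (x + h *\<^sub>R One)) f /\<^sub>R h ^ DIM(real) - f x)
      = \<bar>integral {x..x + h} f / h - f x\<bar>" for x h
    by (simp add: divide_inverse mult.commute)
  show thesis
    using that[of N] N lim unfolding eq negligible_iff_null_sets by blast
qed

text \<open>
  The right-sided statement for the reflected function.
\<close>
lemma left_averages_tendsto:
  fixes f :: "real \<Rightarrow> real"
  assumes "\<And>a b. f integrable_on {a..b}"
  obtains N where "N \<in> null_sets lebesgue"
    and "\<And>t e. t \<notin> N \<Longrightarrow> 0 < e \<Longrightarrow>
      \<exists>d>0. \<forall>h. 0 < h \<and> h < d \<longrightarrow> \<bar>integral {t - h..t} f / h - f t\<bar> < e"
proof -
  have int: "(\<lambda>x. f (- x)) integrable_on {a..b}" for a b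
    using assms[of "-b" "-a"] Henstock_Kurzweil_Integration.integrable_reflect_real[where f = f and a = "-b" and b = "-a"] by simp
  obtain N where N: "N \<in> null_sets lebesgue" and lim: "\<And>t e. t \<notin> N \<Longrightarrow> 0 < e \<Longrightarrow>
      \<exists>d>0. \<forall>h. 0 < h \<and> h < d \<longrightarrow> \<bar>integral {t..t + h} (\<lambda>x. f (- x)) / h - f (- t)\<bar> < e"
    using right_averages_tendsto[OF int] by blast
  have refl: "integral {- t..- t + h} (\<lambda>x. f (- x)) = integral {t - h..t} f" for t h
    using Henstock_Kurzweil_Integration.integral_reflect_real[where f = f and a = "t - h" and b = t] by (simp add: add.commute)
  show thesis
  proof (rule that)
    show "uminus ` N \<in> null_sets lebesgue"
      using N unfolding negligible_iff_null_sets[symmetric]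
      by (intro negligible_differentiable_image_negligible derivative_intros) auto
  next
    fix t e :: real assume "t \<notin> uminus ` N" "0 < e"
    then have "- t \<notin> N"
      by (metis image_eqI minus_minus)
    from lim[OF this \<open>0 < e\<close>] show
      "\<exists>d>0. \<forall>h. 0 < h \<and> h < d \<longrightarrow> \<bar>integral {t - h..t} f / h - f t\<bar> < e"
      unfolding refl minus_minus .
  qed
qed

text \<open>
  The average over \<open>[a, b]\<close> is a convex combination of the averages over \<open>[a, t]\<close> and \<open>[t, b]\<close>.
\<close>
lemma AE_interval_averages:
  fixes f :: "real \<Rightarrow> real"
  assumes int: "\<And>a b. f integrable_on {a..b}"
  shows "AE t in lebesgue. \<forall>e>0. \<exists>d>0. \<forall>a b. a \<le> t \<and> t \<le> b \<and> a < b \<and> b - a < d \<longrightarrow>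
    \<bar>integral {a..b} f / (b - a) - f t\<bar> < e"
proof -
  obtain N1 where N1: "N1 \<in> null_sets lebesgue" "\<And>t e. t \<notin> N1 \<Longrightarrow> 0 < e \<Longrightarrow>
      \<exists>d>0. \<forall>h. 0 < h \<and> h < d \<longrightarrow> \<bar>integral {t..t + h} f / h - f t\<bar> < e"
    using right_averages_tendsto[OF int] by blast
  obtain N2 where N2: "N2 \<in> null_sets lebesgue" "\<And>t e. t \<notin> N2 \<Longrightarrow> 0 < e \<Longrightarrow>
      \<exists>d>0. \<forall>h. 0 < h \<and> h < d \<longrightarrow> \<bar>integral {t - h..t} f / h - f t\<bar> < e"
    using left_averages_tendsto[OF int] by blast
  show ?thesis
    using AE_not_in[OF N1(1)] AE_not_in[OF N2(1)]
  proof eventually_elim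
    fix t assume t: "t \<notin> N1" "t \<notin> N2"
    show "\<forall>e>0. \<exists>d>0. \<forall>a b. a \<le> t \<and> t \<le> b \<and> a < b \<and> b - a < d \<longrightarrow>
      \<bar>integral {a..b} f / (b - a) - f t\<bar> < e"
    proof (intro allI impI)
      fix e :: real assume "0 < e"
      obtain d1 where d1: "0 < d1" "\<And>h. 0 < h \<Longrightarrow> h < d1 \<Longrightarrow> \<bar>integral {t..t + h} f / h - f t\<bar> < e"
        using N1(2)[OF t(1) \<open>0 < e\<close>] by blast
      obtain d2 where d2: "0 < d2" "\<And>h. 0 < h \<Longrightarrow> h < d2 \<Longrightarrow> \<bar>integral {t - h..t} f / h - f t\<bar> < e"
        using N2(2)[OF t(2) \<open>0 < e\<close>] by blast
      have undo: "(X / h - c) * h = X - h * c" if "h \<noteq> 0" for X h c :: real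
        using that by (simp add: field_simps)
      have right: "\<bar>integral {t..b} f - (b - t) * f t\<bar> \<le> e * (b - t)
          \<and> (t < b \<longrightarrow> \<bar>integral {t..b} f - (b - t) * f t\<bar> < e * (b - t))" if "t \<le> b" "b - t < d1" for b
      proof (cases "t < b")
        case True
        have "\<bar>integral {t..b} f / (b - t) - f t\<bar> * (b - t) < e * (b - t)"
          using d1(2)[of "b - t"] True that by (intro mult_strict_right_mono) auto
        also have "\<bar>integral {t..b} f / (b - t) - f t\<bar> * (b - t) = \<bar>(integral {t..b} f / (b - t) - f t) * (b - t)\<bar>"
          using True by (simp add: abs_mult)
        also have "(integral {t..b} f / (b - t) - f t) * (b - t) = integral {t..b} f - (b - t) * f t"
          using True by (intro undo) simp
        finally show ?thesis by simp
      qed (use that in auto)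
      have left: "\<bar>integral {a..t} f - (t - a) * f t\<bar> \<le> e * (t - a)
          \<and> (a < t \<longrightarrow> \<bar>integral {a..t} f - (t - a) * f t\<bar> < e * (t - a))" if "a \<le> t" "t - a < d2" for a
      proof (cases "a < t")
        case True
        have "\<bar>integral {a..t} f / (t - a) - f t\<bar> * (t - a) < e * (t - a)"
          using d2(2)[of "t - a"] True that by (intro mult_strict_right_mono) auto
        also have "\<bar>integral {a..t} f / (t - a) - f t\<bar> * (t - a) = \<bar>(integral {a..t} f / (t - a) - f t) * (t - a)\<bar>"
          using True by (simp add: abs_mult)
        also have "(integral {a..t} f / (t - a) - f t) * (t - a) = integral {a..t} f - (t - a) * f t"
          using True by (intro undo) simp
        finally show ?thesis by simp
      qed (use that in auto)
      show "\<exists>d>0. \<forall>a b. a \<le> t \<and> t \<le> b \<and> a < b \<and> b - a < d \<longrightarrow> \<bar>integral {a..b} f / (b - a) - f t\<bar> < e"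
      proof (intro exI[of _ "min d1 d2"] conjI allI impI)
        fix a b assume ab: "a \<le> t \<and> t \<le> b \<and> a < b \<and> b - a < min d1 d2"
        have comb: "integral {a..b} f = integral {a..t} f + integral {t..b} f"
          using ab int[of a b] by (subst Henstock_Kurzweil_Integration.integral_combine) auto
        define X where "X = integral {a..t} f - (t - a) * f t"
        define Y where "Y = integral {t..b} f - (b - t) * f t"
        have "a < t \<or> t < b" using ab by linarith
        then have "\<bar>X\<bar> + \<bar>Y\<bar> < e * (t - a) + e * (b - t)"
          using left[of a, folded X_def] right[of b, folded Y_def] ab
          by (auto intro: add_less_le_mono add_le_less_mono)
        moreover have "integral {a..b} f - (b - a) * f t = X + Y"
          unfolding comb X_def Y_def by (simp add: algebra_simps)
        moreover have "e * (t - a) + e * (b - t) = e * (b - a)"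
          by (simp add: algebra_simps)
        ultimately have "\<bar>integral {a..b} f - (b - a) * f t\<bar> < e * (b - a)"
          using abs_triangle_ineq[of X Y] by linarith
        moreover have "integral {a..b} f / (b - a) - f t = (integral {a..b} f - (b - a) * f t) / (b - a)"
          using ab by (simp add: diff_divide_distrib)
        ultimately show "\<bar>integral {a..b} f / (b - a) - f t\<bar> < e"
          using ab by (simp add: abs_divide divide_less_eq)
      qed (use d1 d2 in auto)
    qed
  qed
qed

lemma AE_dyadic_averages:
  fixes f :: "real \<Rightarrow> real"
  assumes int: "\<And>a b. f integrable_on {a..b}"
  shows "AE t in lebesgue. (\<lambda>m. dyadic_avg f (k + int m) \<lfloor>t * 2 powi (k + int m)\<rfloor>) \<longlonglongrightarrow> f t"
  using AE_interval_averages[OF int]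
proof eventually_elim
  fix t assume t: "\<forall>e>0. \<exists>d>0. \<forall>a b. a \<le> t \<and> t \<le> b \<and> a < b \<and> b - a < d \<longrightarrow>
    \<bar>integral {a..b} f / (b - a) - f t\<bar> < e"
  show "(\<lambda>m. dyadic_avg f (k + int m) \<lfloor>t * 2 powi (k + int m)\<rfloor>) \<longlonglongrightarrow> f t"
  proof (rule tendstoI)
    fix e :: real assume "0 < e"
    then obtain d where d: "0 < d" "\<And>a b. a \<le> t \<Longrightarrow> t \<le> b \<Longrightarrow> a < b \<Longrightarrow> b - a < d \<Longrightarrow>
        \<bar>integral {a..b} f / (b - a) - f t\<bar> < e"
      using t by metis
    have "(\<lambda>m. 2 powi (- k) * (1 / 2) ^ m :: real) \<longlonglongrightarrow> 2 powi (- k) * 0"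
      by (intro tendsto_intros) auto
    moreover have "2 powi (- k) * (1 / 2) ^ m = (2 :: real) powi (- (k + int m))" for m
    proof -
      have "(2 :: real) powi (- k + - int m) = 2 powi (- k) * 2 powi (- int m)"
        by (intro power_int_add) simp
      moreover have "(2 :: real) powi (- int m) = (1 / 2) ^ m"
        by (subst power_int_minus) (simp add: power_one_over inverse_eq_divide)
      ultimately show ?thesis
        by simp
    qed
    ultimately have "(\<lambda>m. (2 :: real) powi (- (k + int m))) \<longlonglongrightarrow> 0"
      by simp
    then have "\<forall>\<^sub>F m in sequentially. (2 :: real) powi (- (k + int m)) < d"
      using d(1) by (rule order_tendstoD)
    then show "\<forall>\<^sub>F m in sequentially. dist (dyadic_avg f (k + int m) \<lfloor>t * 2 powi (k + int m)\<rfloor>) (f t) < e"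
    proof eventually_elim
      fix m assume m: "(2 :: real) powi (- (k + int m)) < d"
      let ?l = "k + int m" and ?n = "\<lfloor>t * 2 powi (k + int m)\<rfloor>"
      have "\<bar>integral {dyadic_point ?l ?n..dyadic_point ?l (?n + 1)} f
          / (dyadic_point ?l (?n + 1) - dyadic_point ?l ?n) - f t\<bar> < e"
        using dyadic_contains_floor[of t ?l] dyadic_point_less[of ?l ?n] m
        by (intro d(2)) (auto simp: dyadic_point_next)
      then show "dist (dyadic_avg f ?l ?n) (f t) < e"
        by (simp add: dyadic_avg_def dyadic_def dist_real_def dyadic_point_next)
    qed
  qed
qed

section \<open>Weights and their dyadic averages\<close>

lemma dyadic_sets: "dyadic k n \<in> sets lebesgue"
  by (simp add: dyadic_def)

lemma measure_dyadic: "measure lebesgue (dyadic k n) = 2 powi (- k)"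
  using dyadic_point_less[of k n] by (simp add: dyadic_def dyadic_point_next)

lemma emeasure_dyadic_pos: "emeasure lebesgue (dyadic k n) \<noteq> 0"
  using dyadic_point_less[of k n] by (simp add: dyadic_def dyadic_point_next)

lemma mean_dyadic:
  assumes int: "set_integrable lebesgue (dyadic k n) f" and pos: "AE x in lebesgue. 0 \<le> f x"
  shows "mean f (dyadic k n) = ereal (dyadic_avg f k n)" "0 \<le> dyadic_avg f k n"
proof -
  let ?I = "dyadic k n"
  have AE: "AE x in lebesgue. 0 \<le> f x * indicator ?I x"
    using pos by eventually_elim (auto simp: indicator_def)
  have "(\<integral>\<^sup>+x\<in>?I. ennreal (f x) \<partial>lebesgue) = ennreal (set_lebesgue_integral lebesgue ?I f)"
    unfolding set_lebesgue_integral_def nn_integral_set_ennreal using int AE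
    by (subst nn_integral_eq_integral) (simp_all add: mult_ac set_integrable_def)
  moreover have "0 \<le> set_lebesgue_integral lebesgue ?I f"
    unfolding set_lebesgue_integral_def
    by (intro Bochner_Integration.integral_nonneg_AE eventually_mono[OF AE]) (auto simp: mult_ac)
  moreover have "set_lebesgue_integral lebesgue ?I f = integral ?I f"
    using int by (rule set_lebesgue_integral_eq_integral)
  ultimately show "mean f ?I = ereal (dyadic_avg f k n)" "0 \<le> dyadic_avg f k n"
    by (simp_all add: mean_def measure_dyadic dyadic_avg_def)
qed

lemma set_integrable_dyadic_of_mean:
  assumes f: "f \<in> borel_measurable lebesgue" and pos: "AE x in lebesgue. 0 \<le> f x"
    and fin: "mean f (dyadic k n) \<noteq> \<infinity>"
  shows "set_integrable lebesgue (dyadic k n) f"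
  unfolding set_integrable_def
proof (rule integrableI_nonneg)
  show "(\<lambda>x. indicator (dyadic k n) x *\<^sub>R f x) \<in> borel_measurable lebesgue"
    using f dyadic_sets[of k n] by measurable
  show "AE x in lebesgue. 0 \<le> indicator (dyadic k n) x *\<^sub>R f x"
    using pos by eventually_elim (auto simp: indicator_def)
  let ?N = "\<integral>\<^sup>+x\<in>dyadic k n. ennreal (f x) \<partial>lebesgue"
  have "?N \<noteq> \<infinity>"
  proof
    assume "?N = \<infinity>"
    then show False
      using fin by (simp add: mean_def measure_dyadic)
  qed
  moreover have "(\<integral>\<^sup>+x. ennreal (indicator (dyadic k n) x *\<^sub>R f x) \<partial>lebesgue) = ?N"
    by (intro nn_integral_cong) (simp split: split_indicator)
  ultimately show "(\<integral>\<^sup>+x. ennreal (indicator (dyadic k n) x *\<^sub>R f x) \<partial>lebesgue) < \<infinity>"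
    by (simp add: top.not_eq_extremum)
qed

lemma weight_integrable:
  assumes "weight w"
  shows "set_integrable lebesgue {a..b} w"
  using assms by (auto simp: weight_def)

lemma weight_dyadic_integrable: "weight w \<Longrightarrow> set_integrable lebesgue (dyadic k n) w"
  by (simp add: dyadic_def weight_integrable)

lemma weight_borel_measurable:
  assumes "weight w"
  shows "w \<in> borel_measurable lebesgue"
proof (rule borel_measurable_LIMSEQ_real)
  fix i :: nat
  show "(\<lambda>x. indicator {- real i..real i} x *\<^sub>R w x) \<in> borel_measurable lebesgue"
    using weight_integrable[OF assms, of "- real i" "real i"] unfolding set_integrable_def
    by (rule borel_measurable_integrable)
next
  fix x
  obtain m :: nat where "\<bar>x\<bar> \<le> real m"
    using real_arch_simple by blast
  then have "indicator {- real i..real i} x *\<^sub>R w x = w x" if "m \<le> i" for i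
    using that by (auto simp: indicator_def)
  then show "(\<lambda>i. indicator {- real i..real i} x *\<^sub>R w x) \<longlonglongrightarrow> w x"
    by (intro tendsto_eventually eventually_sequentiallyI[of m])
qed

lemma weight_mean:
  assumes "weight w"
  shows "mean w (dyadic k n) = ereal (dyadic_avg w k n)" "0 < dyadic_avg w k n"
proof -
  have pos: "AE x in lebesgue. 0 < w x" and pos': "AE x in lebesgue. 0 \<le> w x"
    using assms by (auto simp: weight_def elim: eventually_mono)
  note avg = mean_dyadic[OF weight_dyadic_integrable[OF assms] pos']
  show "mean w (dyadic k n) = ereal (dyadic_avg w k n)"
    by (rule avg)
  have "mean w (dyadic k n) \<noteq> 0"
  proof
    assume "mean w (dyadic k n) = 0"
    then have "(\<integral>\<^sup>+x. ennreal (w x) * indicator (dyadic k n) x \<partial>lebesgue) = 0"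
      by (cases "\<integral>\<^sup>+x. ennreal (w x) * indicator (dyadic k n) x \<partial>lebesgue")
        (auto simp: mean_def measure_dyadic)
    then have "AE x in lebesgue. ennreal (w x) * indicator (dyadic k n) x = 0"
      using weight_borel_measurable[OF assms] dyadic_sets[of k n]
      by (subst (asm) nn_integral_0_iff_AE) auto
    with pos have "AE x in lebesgue. x \<notin> dyadic k n"
      by eventually_elim (auto simp: indicator_def split: if_splits)
    then show False
      using dyadic_sets[of k n] emeasure_dyadic_pos[of k n]
      by (subst (asm) AE_iff_measurable[OF _ refl]) auto
  qed
  then show "0 < dyadic_avg w k n"
    using avg[of k n] by simp
qed

lemma doubling_dyadic_avg:
  assumes "weight w" and "dyadic_doubling_const w \<le> ereal Q"
  shows "dyadic_avg w k (m div 2) \<le> Q * dyadic_avg w (k + 1) m"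
proof -
  have "mean w (dyadic_parent (dyadic (k + 1) m)) / mean w (dyadic (k + 1) m) \<le> dyadic_doubling_const w"
    unfolding dyadic_doubling_const_def by (rule SUP_upper) (rule dyadic_in_dyadic_intervals)
  also have "\<dots> \<le> ereal Q" by fact
  finally show ?thesis
    unfolding dyadic_parent_dyadic weight_mean(1)[OF assms(1)]
    using weight_mean(2)[OF assms(1), of "k + 1" m] by (simp add: divide_le_eq)
qed

lemma RH_dyadic_avg:
  assumes "0 < p" "w \<in> RH_dyadic p \<delta> J" "dyadic k n \<subseteq> J"
  shows "set_integrable lebesgue (dyadic k n) (\<lambda>x. w x powr p)"
    and "mean (\<lambda>x. w x powr p) (dyadic k n) = ereal (dyadic_avg (\<lambda>x. w x powr p) k n)"
    and "0 \<le> dyadic_avg (\<lambda>x. w x powr p) k n"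
    and "dyadic_avg (\<lambda>x. w x powr p) k n \<le> \<delta> powr p * dyadic_avg w k n powr p"
proof -
  let ?wp = "\<lambda>x. w x powr p"
  have w: "weight w"
    using assms by (simp add: RH_dyadic_def)
  note avg = weight_mean[OF w, of k n]
  have "dyadic k n \<in> dyadic_subintervals J"
    using assms by (simp add: dyadic_subintervals_def dyadic_in_dyadic_intervals)
  then have "epowr (mean ?wp (dyadic k n)) (1 / p) / mean w (dyadic k n)
      \<le> (SUP I\<in>dyadic_subintervals J. epowr (mean ?wp I) (1 / p) / mean w I)"
    by (rule SUP_upper)
  also have "\<dots> \<le> ereal \<delta>"
    using assms by (simp add: RH_dyadic_def)
  finally have rh: "epowr (mean ?wp (dyadic k n)) (1 / p) / ereal (dyadic_avg w k n) \<le> ereal \<delta>"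
    by (simp add: avg)
  have fin: "mean ?wp (dyadic k n) \<noteq> \<infinity>"
    using rh avg(2) by (auto simp: epowr_def)
  have meas: "?wp \<in> borel_measurable lebesgue"
    using weight_borel_measurable[OF w] by measurable
  show int: "set_integrable lebesgue (dyadic k n) ?wp"
    using meas fin by (intro set_integrable_dyadic_of_mean) auto
  show mean: "mean ?wp (dyadic k n) = ereal (dyadic_avg ?wp k n)"
    and nonneg: "0 \<le> dyadic_avg ?wp k n"
    using mean_dyadic[OF int] by auto
  have "dyadic_avg ?wp k n powr (1 / p) \<le> \<delta> * dyadic_avg w k n"
    using rh avg(2) by (simp add: mean epowr_def field_simps)
  then have "(dyadic_avg ?wp k n powr (1 / p)) powr p \<le> (\<delta> * dyadic_avg w k n) powr p"
    using assms by (intro powr_mono2) auto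
  then show "dyadic_avg ?wp k n \<le> \<delta> powr p * dyadic_avg w k n powr p"
    using nonneg assms by (simp add: powr_powr powr_mult)
qed

text \<open>
  Jensen's inequality, by integrating the tangent to \<open>t\<^sup>p\<close> at the mean of \<open>w\<close>.
\<close>
lemma powr_dyadic_avg_le:
  assumes "1 < p" "weight w" "set_integrable lebesgue (dyadic k n) (\<lambda>x. w x powr p)"
  shows "dyadic_avg w k n powr p \<le> dyadic_avg (\<lambda>x. w x powr p) k n"
proof -
  let ?I = "dyadic k n" and ?L = "2 powi (- k) :: real"
  define c where "c = dyadic_avg w k n"
  have c: "0 < c"
    using weight_mean[OF assms(2)] by (simp add: c_def)
  have int_w: "w integrable_on ?I" "integral ?I w = c * ?L"
    using set_lebesgue_integral_eq_integral(1)[OF weight_dyadic_integrable[OF assms(2)]]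
    by (auto simp: c_def dyadic_avg_def)
  have int_line: "((\<lambda>x. (1 - p) * c powr p + p * c powr (p - 1) * w x) has_integral
      (1 - p) * c powr p * ?L + p * c powr (p - 1) * (c * ?L)) ?I"
  proof (rule has_integral_add)
    show "((\<lambda>x. (1 - p) * c powr p) has_integral (1 - p) * c powr p * ?L) ?I"
      using has_integral_const_real[of "(1 - p) * c powr p" "dyadic_point k n" "dyadic_point k (n + 1)"]
      by (simp add: dyadic_def dyadic_point_next mult.commute)
    show "((\<lambda>x. p * c powr (p - 1) * w x) has_integral p * c powr (p - 1) * (c * ?L)) ?I"
      using int_w by (intro has_integral_mult_right) (simp add: has_integral_iff)
  qed
  have tl: "(\<lambda>x. tangent_line p c (w x)) = (\<lambda>x. (1 - p) * c powr p + p * c powr (p - 1) * w x)"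
    by (simp add: tangent_line_def mult_ac)
  have "(1 - p) * c powr p * ?L + p * c powr (p - 1) * (c * ?L) = tangent_line p c c * ?L"
    by (simp add: tangent_line_def algebra_simps)
  then have val: "integral ?I (\<lambda>x. tangent_line p c (w x)) = c powr p * ?L"
    using int_line tangent_line_self[OF c, of p] unfolding tl by (simp add: has_integral_iff)
  have "set_integrable lebesgue ?I (\<lambda>x. (1 - p) * c powr p + p * c powr (p - 1) * w x)"
    using weight_dyadic_integrable[OF assms(2), of k n]
    by (intro set_integral_add set_integrable_mult_right)
       (auto simp: dyadic_def)
  then have int_tl: "set_integrable lebesgue ?I (\<lambda>x. tangent_line p c (w x))"
    by (simp only: tl)
  have "AE x in lebesgue. 0 < w x"
    using assms by (simp add: weight_def)
  then have "AE x\<in>?I in lebesgue. tangent_line p c (w x) \<le> w x powr p"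
    by eventually_elim (use tangent_line_le_powr assms c in auto)
  then have "(LINT x:?I|lebesgue. tangent_line p c (w x)) \<le> (LINT x:?I|lebesgue. w x powr p)"
    by (rule set_integral_mono_AE[OF int_tl assms(3)])
  then have "c powr p * ?L \<le> integral ?I (\<lambda>x. w x powr p)"
    using set_lebesgue_integral_eq_integral(2)[OF int_tl]
      set_lebesgue_integral_eq_integral(2)[OF assms(3)] val by simp
  then show ?thesis
    by (simp add: dyadic_avg_def[of "\<lambda>x. w x powr p"] c_def[symmetric] le_divide_eq)
qed

text \<open>
  Fatou's lemma for the powers of the dyadic averages, which converge almost everywhere.
\<close>
lemma mean_powr_le_of_dyadic_bound:
  assumes w: "weight w"
    and bound: "\<And>m. (\<integral>\<^sup>+t\<in>{dyadic_point k n..<dyadic_point k (n + 1)}.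
      ennreal (dyadic_avg w (k + int m) \<lfloor>t * 2 powi (k + int m)\<rfloor> powr q) \<partial>lebesgue) \<le> ennreal (2 powi (- k) * c)"
    and c: "0 \<le> c"
  shows "mean (\<lambda>x. w x powr q) (dyadic k n) \<le> ereal c"
proof -
  define I where "I = {dyadic_point k n..<dyadic_point k (n + 1)}"
  define F where "F = (\<lambda>m t. ennreal (dyadic_avg w (k + int m) \<lfloor>t * 2 powi (k + int m)\<rfloor> powr q) * indicator I t)"
  have F_meas: "F m \<in> borel_measurable lebesgue" for m
    unfolding F_def I_def
    using borel_measurable_dyadic_step[of "\<lambda>k n. dyadic_avg w k n powr q" "k + int m"]
    by (intro borel_measurable_times_ennreal borel_measurable_indicator) auto
  have int: "w integrable_on {a..b}" for a b
    using set_lebesgue_integral_eq_integral(1)[OF weight_integrable[OF w]] .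
  have pos: "AE t in lebesgue. 0 < w t"
    using w by (simp add: weight_def)
  \<comment> \<open>The dyadic interval is closed, the integrals of the step functions run over half-open ones.\<close>
  have end_null: "AE t in lebesgue. t \<noteq> dyadic_point k (n + 1)"
    by (intro AE_completion AE_lborel_singleton)
  let ?N = "\<integral>\<^sup>+t\<in>dyadic k n. ennreal (w t powr q) \<partial>lebesgue"
  have "?N = (\<integral>\<^sup>+t. liminf (\<lambda>m. F m t) \<partial>lebesgue)"
  proof (rule nn_integral_cong_AE)
    show "AE t in lebesgue. ennreal (w t powr q) * indicator (dyadic k n) t = liminf (\<lambda>m. F m t)"
      using AE_dyadic_averages[OF int, of k] pos end_null
    proof eventually_elim
      fix t assume t: "(\<lambda>m. dyadic_avg w (k + int m) \<lfloor>t * 2 powi (k + int m)\<rfloor>) \<longlonglongrightarrow> w t"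
        "0 < w t" "t \<noteq> dyadic_point k (n + 1)"
      have ind: "indicator (dyadic k n) t = (indicator I t :: ennreal)"
        using t(3) by (auto simp: indicator_def I_def dyadic_def)
      have "(\<lambda>m. F m t) \<longlonglongrightarrow> ennreal (w t powr q) * indicator I t"
        unfolding F_def using t
        by (cases "t \<in> I") (auto intro!: tendsto_ennrealI tendsto_powr)
      then show "ennreal (w t powr q) * indicator (dyadic k n) t = liminf (\<lambda>m. F m t)"
        unfolding ind by (simp add: lim_imp_Liminf)
    qed
  qed
  also have "\<dots> \<le> liminf (\<lambda>m. integral\<^sup>N lebesgue (F m))"
    by (rule nn_integral_liminf) (rule F_meas)
  also have "\<dots> \<le> liminf (\<lambda>m::nat. ennreal (2 powi (- k) * c))"
    using bound unfolding F_def I_def by (intro Liminf_mono) auto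
  also have "\<dots> = ennreal (2 powi (- k) * c)"
    by (simp add: Liminf_const)
  finally have N: "?N \<le> ennreal (2 powi (- k) * c)" .
  then obtain r where r: "0 \<le> r" "?N = ennreal r"
    by (cases ?N) (auto simp: top_unique)
  then have "r \<le> 2 powi (- k) * c"
    using N c by simp
  then show ?thesis
    using r by (simp add: mean_def measure_dyadic divide_le_eq mult.commute)
qed

section \<open>The bound for the Bellman function\<close>

text \<open>
  The bound is the envelope in the coordinate \<open>z = y / \<epsilon>\<^sup>p\<close>, times the constant that makes it equal to
  \<open>x\<^sup>q\<close> for \<open>y = x\<^sup>p\<close>. The reverse Hoelder and doubling conditions say precisely that the
  dyadic splittings of \<open>J\<close> are of the kind along which the envelope is midpoint concave.
\<close>
lemma mean_powr_le_envelope: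
  assumes "1 < p" "q < 0" "1 < Q" "1 < \<delta>"
    and w: "w \<in> RH_dyadic p \<delta> J" and Db: "dyadic_doubling_const w \<le> ereal Q"
    and J: "J = dyadic k n"
  defines "\<epsilon> \<equiv> eps_const p \<delta> Q"
  defines "s \<equiv> s_minus p \<epsilon>"
  assumes "1 / s < q"
  shows "mean (\<lambda>x. w x powr q) J \<le> ereal ((1 - s) powr q / (1 - q * s) *
    envelope p q (dyadic_avg w k n) (dyadic_avg (\<lambda>x. w x powr p) k n / \<epsilon> powr p))"
proof -
  define C where "C = (1 - s) powr q / (1 - q * s)"
  define X where "X = dyadic_avg w"
  define Z where "Z = (\<lambda>k n. dyadic_avg (\<lambda>x. w x powr p) k n / \<epsilon> powr p)"
  have weight: "weight w"
    using w by (simp add: RH_dyadic_def)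
  have eps: "1 < \<epsilon>" "\<epsilon> powr p = chord_excess p Q * \<delta> powr p"
    using eps_const_gt_1 eps_const_powr(2)[of p Q \<delta>] assms by (auto simp: \<epsilon>_def)
  have s: "s < 0" "q * s < 1"
    using s_minus_neg[of p \<epsilon> q] eps assms by (auto simp: s_def)
  have C: "0 < C"
    using s by (simp add: C_def)
  have kappa: "1 < chord_excess p Q"
    using chord_excess_gt_1 assms by blast
  have X: "0 < X k n" for k n
    using weight_mean(2)[OF weight] by (simp add: X_def)
  have Xq: "X k n powr q \<le> C * envelope p q (X k n) (Z k n)"
    and Z: "0 < Z k n" "chord_excess p Q * Z k n \<le> X k n powr p"
    if sub: "dyadic k n \<subseteq> J" for k n
  proof -
    let ?Y = "dyadic_avg (\<lambda>x. w x powr p) k n"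
    have low: "X k n powr p \<le> ?Y"
      unfolding X_def using assms sub by (intro powr_dyadic_avg_le RH_dyadic_avg weight) auto
    have up: "?Y \<le> \<delta> powr p * X k n powr p"
      unfolding X_def using assms sub by (intro RH_dyadic_avg) auto
    have "\<delta> powr p * X k n powr p \<le> \<epsilon> powr p * X k n powr p"
      unfolding eps using mult_right_mono[of 1 "chord_excess p Q" "\<delta> powr p"] kappa
      by (intro mult_right_mono) auto
    with up have "?Y \<le> \<epsilon> powr p * X k n powr p"
      by (rule order_trans)
    then show "X k n powr q \<le> C * envelope p q (X k n) (Z k n)"
      unfolding C_def Z_def s_def using assms(1,2) X s eps(1) low
      by (intro normalized_envelope_lower) (auto simp: s_def)
    have "0 < X k n powr p"
      using X[of k n] by simp
    also note low
    finally show "0 < Z k n"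
      using eps(1) unfolding Z_def by (intro divide_pos_pos) auto
    show "chord_excess p Q * Z k n \<le> X k n powr p"
      using up kappa assms(4) by (simp add: Z_def eps divide_le_eq mult.commute)
  qed
  have halves: "C * envelope p q (X (k + 1) (2 * n)) (Z (k + 1) (2 * n))
      + C * envelope p q (X (k + 1) (2 * n + 1)) (Z (k + 1) (2 * n + 1))
    \<le> 2 * (C * envelope p q (X k n) (Z k n))" if sub: "dyadic k n \<subseteq> J" for k n
  proof -
    have sub': "dyadic (k + 1) (2 * n) \<subseteq> J" "dyadic (k + 1) (2 * n + 1) \<subseteq> J"
      using dyadic_half_subset[of k n] sub by auto
    have Xm: "X k n = (X (k + 1) (2 * n) + X (k + 1) (2 * n + 1)) / 2"
      unfolding X_def
      using set_lebesgue_integral_eq_integral(1)[OF weight_dyadic_integrable[OF weight]]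
      by (rule dyadic_avg_halves)
    have Zm: "Z k n = (Z (k + 1) (2 * n) + Z (k + 1) (2 * n + 1)) / 2"
      unfolding Z_def using assms(1) sub w
      by (subst dyadic_avg_halves)
        (auto intro!: set_lebesgue_integral_eq_integral(1) RH_dyadic_avg simp: add_divide_distrib)
    have "envelope p q (X (k + 1) (2 * n)) (Z (k + 1) (2 * n))
        + envelope p q (X (k + 1) (2 * n + 1)) (Z (k + 1) (2 * n + 1))
      \<le> 2 * envelope p q (X k n) (Z k n)"
      unfolding Xm Zm
    proof (rule envelope_midpoint_of_ratio[where Q = Q], unfold Xm[symmetric] Zm[symmetric])
      show "X k n \<le> Q * X (k + 1) (2 * n)" "X k n \<le> Q * X (k + 1) (2 * n + 1)"
        using doubling_dyadic_avg[OF weight Db, of k "2 * n"]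
          doubling_dyadic_avg[OF weight Db, of k "2 * n + 1"] by (auto simp: X_def)
    qed (use assms X Z sub sub' in auto)
    then show ?thesis
      using mult_left_mono[of _ _ C] C by (fastforce simp: algebra_simps)
  qed
  have nonneg: "0 \<le> C * envelope p q (X k n) (Z k n)" if "dyadic k n \<subseteq> J" for k n
    using Xq[OF that] order_trans[OF powr_ge_zero] by blast
  show ?thesis
    unfolding J C_def[symmetric] X_def[symmetric]
  proof (rule mean_powr_le_of_dyadic_bound[OF weight])
    show "0 \<le> C * envelope p q (X k n) (dyadic_avg (\<lambda>x. w x powr p) k n / \<epsilon> powr p)"
      using nonneg[of k n] J by (simp add: Z_def)
  next
    fix m
    show "(\<integral>\<^sup>+t\<in>{dyadic_point k n..<dyadic_point k (n + 1)}.
        ennreal (dyadic_avg w (k + int m) \<lfloor>t * 2 powi (k + int m)\<rfloor> powr q) \<partial>lebesgue)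
      \<le> ennreal (2 powi (- k) * (C * envelope p q (X k n) (dyadic_avg (\<lambda>x. w x powr p) k n / \<epsilon> powr p)))"
      using nn_integral_dyadic_step_le[of J "\<lambda>k n. X k n powr q" "\<lambda>k n. C * envelope p q (X k n) (Z k n)"]
        Xq nonneg halves J by (simp add: Z_def X_def)
  qed
qed

theorem theorem1p1:
  fixes p q \<delta> Q \<epsilon> s r x y :: real and J :: "real set"
  assumes "p > 1" and "Q \<ge> 2" and "\<delta> > 1"
    and "J \<in> dyadic_intervals"
    and "\<epsilon> = eps_const p \<delta> Q"
    and "s = s_minus p \<epsilon>"
    and "q \<in> {1 / s <..< 0}"
    and "(x, y) \<in> bellman_domain p \<delta> Q J"
    and "r = u_minus p (y powr (1 / p) / (\<epsilon> * x))"
  shows "bellman x y p q \<delta> Q J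
           \<le> ereal (x powr q * ((1 - q * r) / (1 - q * s)) * ((1 - s) / (1 - r)) powr q)
       \<and> x powr q * ((1 - q * r) / (1 - q * s)) * ((1 - s) / (1 - r)) powr q
           = y powr (q / p) * ((1 - q * r) / (1 - q * s))
               * ((1 - p * s) / (1 - p * r)) powr (q / p)"
proof -
  have q: "1 / s < q" "q < 0"
    using assms(7) by auto
  have Q: "1 < Q"
    using assms(2) by simp
  have eps: "1 < \<epsilon>" "\<epsilon> powr p = chord_excess p Q * \<delta> powr p"
    using eps_const_gt_1[OF assms(1) Q assms(3)] eps_const_powr(2)[OF assms(1) Q, of \<delta>] assms(3,5) by auto
  have kappa: "1 < chord_excess p Q"
    using chord_excess_gt_1[OF assms(1) Q] .
  have s: "s < 0" "q * s < 1"
    using s_minus_neg[of p \<epsilon> q] assms(1,6) eps q by auto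
  obtain k n where J: "J = dyadic k n"
    using assms(4) by (auto simp: dyadic_intervals_eq)
  have averages: "dyadic_avg w k n = x \<and> dyadic_avg (\<lambda>x. w x powr p) k n = y"
    if "w \<in> RH_dyadic p \<delta> J" "mean w J = ereal x" "mean (\<lambda>x. w x powr p) J = ereal y" for w
    using that weight_mean(1)[of w k n] RH_dyadic_avg(2)[of p w \<delta> J k n] assms(1)
    by (auto simp: J RH_dyadic_def)
  obtain w0 where w0: "w0 \<in> RH_dyadic p \<delta> J" "mean w0 J = ereal x" "mean (\<lambda>x. w0 x powr p) J = ereal y"
    using assms(8) by (auto simp: bellman_domain_def)
  have weight: "weight w0"
    using w0 by (simp add: RH_dyadic_def)
  have x: "0 < x"
    using weight_mean(2)[OF weight, of k n] averages[OF w0] by simp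
  have "x powr p \<le> y"
    using powr_dyadic_avg_le[OF assms(1) weight RH_dyadic_avg(1)[of p w0 \<delta> J k n]] averages[OF w0] w0 assms(1) J
    by auto
  then have y: "0 < y"
    using x by (smt (verit) powr_gt_zero)
  have "y \<le> \<delta> powr p * x powr p"
    using RH_dyadic_avg(4)[of p w0 \<delta> J k n] averages[OF w0] w0 assms(1) J by auto
  also have "\<dots> \<le> \<epsilon> powr p * x powr p"
    unfolding eps using mult_right_mono[of 1 "chord_excess p Q" "\<delta> powr p"] kappa
      by (intro mult_right_mono) auto
  finally have z: "0 < y / \<epsilon> powr p" "y / \<epsilon> powr p \<le> x powr p"
    using y eps(1) by (auto simp: divide_le_eq mult.commute)
  have r_arg: "(y / \<epsilon> powr p) powr (1 / p) / x = y powr (1 / p) / (\<epsilon> * x)"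
    using y eps(1) assms(1) by (simp add: powr_divide powr_powr)
  have env: "tangent_line e (tangency p x (y / \<epsilon> powr p)) x = x powr e * ((1 - e * r) * (1 - r) powr (- e))" for e
    using tangent_line_tangency[OF assms(1) x z, of e] by (simp add: r_arg assms(9))
  have r: "r \<le> 0"
    using tangency(1,2)[OF assms(1) x z] x unfolding tangency_def r_arg assms(9)[symmetric]
    by (auto simp: field_simps mult_le_0_iff zero_less_divide_iff)
  let ?B = "x powr q * ((1 - q * r) / (1 - q * s)) * ((1 - s) / (1 - r)) powr q"
  have B: "?B = (1 - s) powr q / (1 - q * s) * envelope p q x (y / \<epsilon> powr p)"
    using s r unfolding envelope_def env by (simp add: powr_divide powr_minus field_simps)
  have "bellman x y p q \<delta> Q J \<le> ereal ?B"
    unfolding bellman_def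
  proof (rule Sup_least)
    fix v assume "v \<in> {mean (\<lambda>x. w x powr q) J | w. w \<in> RH_dyadic p \<delta> J \<and> dyadic_doubling_const w \<le> ereal Q \<and>
            mean w J = ereal x \<and> mean (\<lambda>x. w x powr p) J = ereal y}"
    then obtain w where w: "w \<in> RH_dyadic p \<delta> J" "dyadic_doubling_const w \<le> ereal Q"
        "mean w J = ereal x" "mean (\<lambda>x. w x powr p) J = ereal y" "v = mean (\<lambda>x. w x powr q) J"
      by blast
    show "v \<le> ereal ?B"
      unfolding B w(5)
      using mean_powr_le_envelope[OF assms(1) q(2) Q assms(3) w(1,2) J] q averages[OF w(1,3,4)]
      by (simp add: assms(5,6))
  qed
  moreover have "?B = y powr (q / p) * ((1 - q * r) / (1 - q * s)) * ((1 - p * s) / (1 - p * r)) powr (q / p)"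
  proof -
    have pr: "0 < 1 - p * r"
      using r assms(1) by (smt (verit) mult_nonneg_nonpos)
    have ps: "0 < 1 - p * s"
      using s assms(1) by (smt (verit) mult_pos_neg)
    have "y / \<epsilon> powr p = x powr p * ((1 - p * r) * (1 - r) powr (- p))"
      using env[of p] tangency(3)[OF assms(1) x z] by simp
    moreover have "(1 - p * s) * (1 - s) powr (- p) = (1 / \<epsilon>) powr p"
      using tangent_line_unit[of s p] u_minus_solves(2)[of p "1 / \<epsilon>"] s eps assms(1)
      by (simp add: assms(6) s_minus_def)
    ultimately have y_eq: "y = \<epsilon> powr p * x powr p * (1 - p * r) / (1 - r) powr p"
      and s_eq: "1 - p * s = (1 - s) powr p / \<epsilon> powr p"
      using s r eps(1) by (simp_all add: powr_minus powr_divide divide_simps)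
    have "y * ((1 - p * s) / (1 - p * r)) = x powr p * ((1 - s) powr p / (1 - r) powr p)"
      unfolding s_eq using pr eps(1) by (simp add: y_eq)
    then have "y * ((1 - p * s) / (1 - p * r)) = (x * ((1 - s) / (1 - r))) powr p"
      using s r by (simp add: powr_mult powr_divide)
    then have "(y * ((1 - p * s) / (1 - p * r))) powr (q / p) = ((x * ((1 - s) / (1 - r))) powr p) powr (q / p)"
      by simp
    then have "y powr (q / p) * ((1 - p * s) / (1 - p * r)) powr (q / p) = x powr q * ((1 - s) / (1 - r)) powr q"
      unfolding powr_powr powr_mult using assms(1) by simp
    then show ?thesis
      by (simp add: mult_ac)
  qed
  ultimately show ?thesis by blast
qed

end
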